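(* Let $\alpha\in(0,1)$, $\epsilon>0$, let $X$ be a real-valued Lévy process, and let $T_th(x)=\mathbb{E}\,h(x+X(t))$ be its semigroup on $B_b(\mathbb{R})$ (real-valued bounded Borel measurable functions, with the sup-norm), with generator $A$. Let $S_\alpha^{(\epsilon)}$ be the subordinator, independent of $X$, with Laplace exponent $\frac{\alpha}{\epsilon^\alpha}\gamma(\alpha;\eta\epsilon)$. Then, for $h$ in the domain of $A$, $$T_t^\epsilon h(x)=\mathbb{E}\,h\bigl(x+X(S_\alpha^{(\epsilon)}(t))\bigr)$$ satisfies the equation $$\frac{\partial}{\partial t}g(x,t)=\int_\epsilon^\infty\bigl(T_sg(x,t)-g(x,t)\bigr)\frac{\alpha(s-\epsilon)^{-\alpha}s^{-1}}{\Gamma(1-\alpha)}\,ds,\qquad g(x,0)=h(x).$$ The operator on the right-hand side is an approximation of the fractional power $$-(-A)^\alpha h(x)=\int_0^\infty\bigl(T_sh(x)-h(x)\bigr)\frac{\alpha}{\Gamma(1-\alpha)}s^{-\alpha-1}\,ds$$ (defined at least on the domain of $A$), to which it converges as $\epsilon\to0$.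
   Context: $\gamma(\alpha;x)=\int_0^x e^{-w}w^{\alpha-1}\,dw$ is the lower-incomplete gamma function. A subordinator is a Lévy process $S$ with non-decreasing paths; its Laplace exponent $\varphi$ is defined by $\mathbb{E}e^{-\eta S(t)}=e^{-t\varphi(\eta)}$. The subordinator $S_\alpha^{(\epsilon)}$ has Lévy density $\frac{\alpha}{\Gamma(1-\alpha)}(s-\epsilon)^{-\alpha}s^{-1}1_{s\ge\epsilon}$. $(T_t)_{t\ge0}$ is taken to be a strongly continuous contraction semigroup on $B_b(\mathbb{R})$; $T_s$ acts on the variable $x$ of $g(x,t)$. *)

theory Defs
  imports "HOL-Probability.Probability"
begin

definition lower_incomplete_gamma :: "real \<Rightarrow> real \<Rightarrow> real" where
  "lower_incomplete_gamma \<alpha> x = (LBINT w:{0..x}. exp (- w) * w powr (\<alpha> - 1))"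

text \<open>Processes are indexed by real times, of which only the nonnegative ones matter.\<close>

definition cadlag :: "(real \<Rightarrow> real) \<Rightarrow> bool" where
  "cadlag f \<longleftrightarrow>
    (\<forall>t\<ge>0. continuous (at_right t) f) \<and> (\<forall>t>0. \<exists>l. (f \<longlongrightarrow> l) (at_left t))"

text \<open>
  The path property is required of every path rather than of almost every one: then
  \<open>(t, \<omega>) \<mapsto> X t \<omega>\<close> is jointly measurable on nonnegative times, so that the
  time-changed variable \<open>\<omega> \<mapsto> X (S t \<omega>) \<omega>\<close> is a random variable even if
  \<open>M\<close> is not complete.
\<close>

definition levy_process :: "'a measure \<Rightarrow> (real \<Rightarrow> 'a \<Rightarrow> real) \<Rightarrow> bool" where
  "levy_process M X \<longleftrightarrow>
    prob_space M \<and>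
    (\<forall>t\<ge>0. X t \<in> borel_measurable M) \<and>
    (AE \<omega> in M. X 0 \<omega> = 0) \<and>
    (\<forall>(n::nat) \<tau>. 0 \<le> \<tau> 0 \<and> (\<forall>i<n. \<tau> i \<le> \<tau> (Suc i)) \<longrightarrow>
       prob_space.indep_vars M (\<lambda>_. borel) (\<lambda>i \<omega>. X (\<tau> (Suc i)) \<omega> - X (\<tau> i) \<omega>) {..<n}) \<and>
    (\<forall>s\<ge>0. \<forall>t\<ge>0. distr M borel (\<lambda>\<omega>. X (s + t) \<omega> - X s \<omega>) = distr M borel (X t)) \<and>
    (\<forall>t\<ge>0. \<forall>e>0.
       ((\<lambda>s. measure M {\<omega> \<in> space M. \<bar>X s \<omega> - X t \<omega>\<bar> > e}) \<longlongrightarrow> 0) (at t within {0..})) \<and>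
    (\<forall>\<omega>\<in>space M. cadlag (\<lambda>t. X t \<omega>))"

text \<open>
  Nonnegativity holds almost surely by monotonicity and \<open>S 0 = 0\<close> a.s.; it is required on
  every path so that \<open>S\<close> can be used as a random time throughout.
\<close>

definition subordinator :: "'a measure \<Rightarrow> (real \<Rightarrow> 'a \<Rightarrow> real) \<Rightarrow> bool" where
  "subordinator M S \<longleftrightarrow>
    levy_process M S \<and>
    (\<forall>\<omega>\<in>space M. 0 \<le> S 0 \<omega> \<and> mono_on {0..} (\<lambda>t. S t \<omega>))"

definition has_laplace_exponent ::
    "'a measure \<Rightarrow> (real \<Rightarrow> 'a \<Rightarrow> real) \<Rightarrow> (real \<Rightarrow> real) \<Rightarrow> bool" where
  "has_laplace_exponent M S \<phi> \<longleftrightarrow>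
    (\<forall>t\<ge>0. \<forall>\<eta>\<ge>0. (\<integral>\<omega>. exp (- \<eta> * S t \<omega>) \<partial>M) = exp (- t * \<phi> \<eta>))"

definition independent_processes ::
    "'a measure \<Rightarrow> (real \<Rightarrow> 'a \<Rightarrow> real) \<Rightarrow> (real \<Rightarrow> 'a \<Rightarrow> real) \<Rightarrow> bool" where
  "independent_processes M X Y \<longleftrightarrow>
    prob_space.indep_var M
      (PiM {0..} (\<lambda>_. borel)) (\<lambda>\<omega>. \<lambda>t\<in>{0..}. X t \<omega>)
      (PiM {0..} (\<lambda>_. borel)) (\<lambda>\<omega>. \<lambda>t\<in>{0..}. Y t \<omega>)"

text \<open>
  The space of bounded Borel functions with the sup-norm is represented by its carrier;
  convergence in norm is \<open>uniform_limit UNIV\<close>.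
\<close>

definition Bb :: "(real \<Rightarrow> real) set" where
  "Bb = {h. h \<in> borel_measurable borel \<and> bounded (range h)}"

definition levy_semigroup ::
    "'a measure \<Rightarrow> (real \<Rightarrow> 'a \<Rightarrow> real) \<Rightarrow> real \<Rightarrow> (real \<Rightarrow> real) \<Rightarrow> real \<Rightarrow> real" where
  "levy_semigroup M X t h x = (\<integral>\<omega>. h (x + X t \<omega>) \<partial>M)"

text \<open>
  The generator, as a graph. Strong continuity of \<open>T\<close> on all of \<open>Bb\<close> is not presupposed:
  it fails for most Levy processes (Brownian motion, for instance), and for \<open>h\<close> in the domain
  \<open>t \<mapsto> T t h\<close> is norm continuous anyway.
\<close>

definition generator ::
    "(real \<Rightarrow> (real \<Rightarrow> real) \<Rightarrow> real \<Rightarrow> real) \<Rightarrow> ((real \<Rightarrow> real) \<times> (real \<Rightarrow> real)) set" where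
  "generator T = {(h, k). h \<in> Bb \<and> k \<in> Bb \<and>
     uniform_limit UNIV (\<lambda>t x. (T t h x - h x) / t) k (at_right 0)}"

definition stable_density :: "real \<Rightarrow> real \<Rightarrow> real" where
  "stable_density \<alpha> s = \<alpha> / Gamma (1 - \<alpha>) * s powr (- \<alpha> - 1)"

definition shifted_density :: "real \<Rightarrow> real \<Rightarrow> real \<Rightarrow> real" where
  "shifted_density \<alpha> \<epsilon> s = \<alpha> * (s - \<epsilon>) powr (- \<alpha>) * s powr (- 1) / Gamma (1 - \<alpha>)"

text \<open>\<open>neg_frac_power T \<alpha>\<close> is minus the \<open>\<alpha>\<close>-th power of \<open>- A\<close>, for the generator \<open>A\<close> of \<open>T\<close>.\<close>

definition neg_frac_power ::
    "(real \<Rightarrow> (real \<Rightarrow> real) \<Rightarrow> real \<Rightarrow> real) \<Rightarrow> real \<Rightarrow> (real \<Rightarrow> real) \<Rightarrow> real \<Rightarrow> real" where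
  "neg_frac_power T \<alpha> h x = (LBINT s:{0<..}. (T s h x - h x) * stable_density \<alpha> s)"

definition approx_neg_frac_power ::
    "(real \<Rightarrow> (real \<Rightarrow> real) \<Rightarrow> real \<Rightarrow> real) \<Rightarrow> real \<Rightarrow> real \<Rightarrow> (real \<Rightarrow> real) \<Rightarrow> real \<Rightarrow> real" where
  "approx_neg_frac_power T \<alpha> \<epsilon> h x =
     (LBINT s:{\<epsilon>..}. (T s h x - h x) * shifted_density \<alpha> \<epsilon> s)"

definition subordinate_semigroup ::
    "'a measure \<Rightarrow> (real \<Rightarrow> 'a \<Rightarrow> real) \<Rightarrow> (real \<Rightarrow> 'a \<Rightarrow> real) \<Rightarrow>
     real \<Rightarrow> (real \<Rightarrow> real) \<Rightarrow> real \<Rightarrow> real" where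
  "subordinate_semigroup M X S t h x = (\<integral>\<omega>. h (x + X (S t \<omega>) \<omega>) \<partial>M)"

end

theory Submission
  imports Defs "HOL-Real_Asymp.Real_Asymp"
begin

text \<open>
  The shifted density has finite mass \<open>c = \<alpha> \<Gamma>(\<alpha>) / \<epsilon>\<^sup>\<alpha>\<close>, so its Laplace exponent is that of a
  compound Poisson process: by uniqueness of Laplace transforms, \<open>S t\<close> has the law
  \<open>e\<^sup>-\<^sup>c\<^sup>t \<Sum>n. (c t)\<^sup>n / n! N\<^sup>*\<^sup>n\<close> with \<open>N\<close> the normalised shifted density. Conditioning on \<open>S t\<close>,
  \<open>T\<^sup>\<epsilon> t h x\<close> is the integral of \<open>u \<mapsto> T u h x\<close> against this law, i.e. an exponentially weighted
  power series in \<open>t\<close> with coefficients bounded by \<open>\<parallel>h\<parallel>\<close>; its second derivative is bounded uniformly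
  in \<open>x\<close>, and its first derivative replaces the \<open>n\<close>-th coefficient by a forward difference, which is the
  operator with the shifted density applied to \<open>T\<^sup>\<epsilon> t h\<close>.

  For \<open>h\<close> in the domain, \<open>\<bar>T s h x - h x\<bar> \<le> C * s\<close>, and the integral of \<open>s\<close> times the absolute
  difference of the two densities is \<open>O(\<epsilon>\<^sup>1\<^sup>-\<^sup>\<alpha>)\<close>.
\<close>

section \<open>The shifted and the stable density\<close>

text \<open>The rate \<alpha> \<Gamma>(\<alpha>) / \<epsilon>^\<alpha> is a transform evaluated at
  \<eta> = 0. Writing exp(-\<eta>s) / s as the integral of exp(-ws) over w \<ge> \<eta> turns the
  Laplace transform of the shifted density into an upper incomplete gamma integral; rate minus
  transform is then exactly the prescribed exponent. Since T need not be strongly continuous on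
  \<open>Bb\<close>, no integral of norm-valued functions is formed. The point x stays fixed, u
  \<mapsto> T u h x is an ordinary bounded Borel function of time, and uniformity in x comes only
  from remainder constants that depend on a bound of h and on the rate. That a forward difference of
  the coefficients is the operator rests on T s (T u h) = T (s + u) h: letting T s act on the
  solution shifts the time variable by s, which is what one more jump of S does. For the limit, s
  times either density fails to be integrable at infinity. Only the difference is integrable, and
  its mass on each of (0, \<epsilon>), (\<epsilon>, 2\<epsilon>) and (2\<epsilon>, \<infinity>) is
  of order \<epsilon>^(1 - \<alpha>).\<close>

lemma nn_integral_exp_atLeast:
  fixes s \<eta> :: real
  assumes "0 < s"
  shows "(\<integral>\<^sup>+w. ennreal (exp (- (w * s))) * indicator {\<eta>..} w \<partial>lborel) = ennreal (exp (- (\<eta> * s)) / s)"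
proof -
  have lim: "((\<lambda>w. - (exp (- (w * s)) / s)) \<longlongrightarrow> 0) at_top"
    using assms by real_asymp
  have "(\<integral>\<^sup>+w. ennreal (exp (- (w * s))) * indicator {\<eta>..} w \<partial>lborel) = ennreal (0 - (- (exp (- (\<eta> * s)) / s)))"
    by (rule nn_integral_FTC_atLeast[OF _ _ _ lim])
       (use assms in \<open>auto intro!: derivative_eq_intros\<close>)
  then show ?thesis by simp
qed

text \<open>The substitution s = \<epsilon> + u / w leads to the Gamma integral. With a = 1 -
  \<alpha> the power of w becomes the exponent \<alpha> - 1 of the incomplete gamma
  integrand.\<close>

lemma nn_integral_gamma_shift:
  fixes a w \<epsilon> :: real
  assumes "0 < a" "0 < w"
  shows "(\<integral>\<^sup>+s. ennreal ((s - \<epsilon>) powr (a - 1) * exp (- (w * s))) * indicator {\<epsilon>..} s \<partial>lborel)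
    = ennreal (Gamma a * w powr (- a) * exp (- (w * \<epsilon>)))"
proof -
  have "(\<integral>\<^sup>+s. ennreal ((s - \<epsilon>) powr (a - 1) * exp (- (w * s))) * indicator {\<epsilon>..} s \<partial>lborel)
    = ennreal \<bar>1 / w\<bar> * (\<integral>\<^sup>+u. ennreal ((\<epsilon> + 1 / w * u - \<epsilon>) powr (a - 1) * exp (- (w * (\<epsilon> + 1 / w * u))))
          * indicator {\<epsilon>..} (\<epsilon> + 1 / w * u) \<partial>lborel)"
    using assms by (intro nn_integral_real_affine) auto
  also have "(\<integral>\<^sup>+u. ennreal ((\<epsilon> + 1 / w * u - \<epsilon>) powr (a - 1) * exp (- (w * (\<epsilon> + 1 / w * u))))
          * indicator {\<epsilon>..} (\<epsilon> + 1 / w * u) \<partial>lborel)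
     = (\<integral>\<^sup>+u. ennreal (w powr (1 - a) * exp (- (w * \<epsilon>))) * ennreal (indicator {0..} u * u powr (a - 1) / exp u) \<partial>lborel)"
  proof (rule nn_integral_cong)
    fix u :: real
    show "ennreal ((\<epsilon> + 1 / w * u - \<epsilon>) powr (a - 1) * exp (- (w * (\<epsilon> + 1 / w * u))))
          * indicator {\<epsilon>..} (\<epsilon> + 1 / w * u)
      = ennreal (w powr (1 - a) * exp (- (w * \<epsilon>))) * ennreal (indicator {0..} u * u powr (a - 1) / exp u)"
    proof (cases "0 \<le> u")
      case True
      have "w powr (1 - a) = 1 / w powr (a - 1)"
        using powr_minus_divide[of w "a - 1"] by simp
      moreover have "w * (\<epsilon> + u / w) = w * \<epsilon> + u" using assms by (simp add: field_simps)
      ultimately show ?thesis using True assms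
        by (simp add: ennreal_mult'[symmetric] powr_divide exp_add exp_diff exp_minus)
    next
      case False
      with assms have "u / w < 0" by (simp add: divide_neg_pos)
      with False show ?thesis by simp
    qed
  qed
  also have "\<dots> = ennreal (w powr (1 - a) * exp (- (w * \<epsilon>))) * ennreal (Gamma a)"
    using assms by (subst nn_integral_cmult) (auto simp: Gamma_conv_nn_integral_real)
  also have "ennreal \<bar>1 / w\<bar> * \<dots> = ennreal (Gamma a * w powr (- a) * exp (- (w * \<epsilon>)))"
    using assms Gamma_real_pos[of a]
    by (simp add: ennreal_mult'[symmetric] powr_diff powr_minus field_simps)
  finally show ?thesis .
qed

text \<open>Splitting the Gamma integral at x counts only the null point x twice. The total is
  finite, so both parts are, and the extended equation can be solved for the upper part in the
  reals.\<close>

lemma nn_integral_upper_incomplete_gamma: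
  fixes a x :: real
  assumes "0 < a" "0 \<le> x"
  shows "(\<integral>\<^sup>+v. ennreal (v powr (a - 1) * exp (- v)) * indicator {x..} v \<partial>lborel)
      = ennreal (Gamma a - lower_incomplete_gamma a x)"
    and "0 \<le> Gamma a - lower_incomplete_gamma a x"
proof -
  let ?g = "\<lambda>v::real. v powr (a - 1) * exp (- v)"
  have G: "(\<integral>\<^sup>+v. ennreal (?g v) * indicator {0..} v \<partial>lborel) = ennreal (Gamma a)"
    unfolding Gamma_conv_nn_integral_real[OF assms(1)]
    by (intro nn_integral_cong) (auto simp: exp_minus field_simps split: split_indicator)
  have "(\<integral>\<^sup>+v. ennreal (?g v) * indicator {0..x} v \<partial>lborel)
      \<le> (\<integral>\<^sup>+v. ennreal (?g v) * indicator {0..} v \<partial>lborel)"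
    by (intro nn_integral_mono) (auto split: split_indicator)
  with G have fin: "(\<integral>\<^sup>+v. ennreal (?g v) * indicator {0..x} v \<partial>lborel) < \<infinity>"
    by (simp add: order_le_less_trans)
  have L: "lower_incomplete_gamma a x = (\<integral>v. indicator {0..x} v * ?g v \<partial>lborel)"
    by (simp add: lower_incomplete_gamma_def set_lebesgue_integral_def mult.commute)
  have "lower_incomplete_gamma a x = enn2real (\<integral>\<^sup>+v. ennreal (?g v) * indicator {0..x} v \<partial>lborel)"
    unfolding L by (subst integral_eq_nn_integral)
      (auto intro!: arg_cong[of _ _ enn2real] nn_integral_cong split: split_indicator)
  with fin have L': "(\<integral>\<^sup>+v. ennreal (?g v) * indicator {0..x} v \<partial>lborel) = ennreal (lower_incomplete_gamma a x)"
    by (simp add: less_top)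
  have Lnn: "0 \<le> lower_incomplete_gamma a x"
    unfolding L by (intro integral_nonneg_AE) auto
  let ?U = "\<integral>\<^sup>+v. ennreal (?g v) * indicator {x..} v \<partial>lborel"
  have "ennreal (Gamma a) = (\<integral>\<^sup>+v. ennreal (?g v) * indicator {0..x} v + ennreal (?g v) * indicator {x..} v \<partial>lborel)"
    unfolding G[symmetric] using assms(2)
    by (intro nn_integral_cong_AE, intro eventually_mono[OF AE_lborel_singleton[of x]])
       (auto split: split_indicator)
  also have "\<dots> = ennreal (lower_incomplete_gamma a x) + ?U"
    by (subst nn_integral_add) (auto simp: L')
  finally have eq: "ennreal (Gamma a) = ennreal (lower_incomplete_gamma a x) + ?U" .
  then have "?U \<noteq> \<top>"
    by auto
  then obtain U where U: "?U = ennreal U" "0 \<le> U" by (cases ?U) auto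
  have "Gamma a = lower_incomplete_gamma a x + U"
    using eq U Lnn Gamma_real_pos[OF assms(1)] by (simp add: ennreal_plus[symmetric] del: ennreal_plus)
  with U show "?U = ennreal (Gamma a - lower_incomplete_gamma a x)"
      "0 \<le> Gamma a - lower_incomplete_gamma a x" by simp_all
qed

lemma shifted_density_nonneg: "0 < \<alpha> \<Longrightarrow> \<alpha> < 1 \<Longrightarrow> 0 \<le> shifted_density \<alpha> \<epsilon> s"
  by (simp add: shifted_density_def Gamma_real_nonneg)

lemma shifted_density_measurable [measurable]: "shifted_density \<alpha> \<epsilon> \<in> borel_measurable borel"
  unfolding shifted_density_def by measurable

text \<open>The factor exp(-\<eta>s) / s is the integral of exp(-ws) over w \<ge> \<eta>. After
  exchanging integrals, the one over s is a shifted Gamma integral whose value \<Gamma>(1 -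
  \<alpha>) cancels the normalisation of the density, and an upper incomplete gamma integral in w
  remains.\<close>

lemma nn_integral_exp_shifted_density:
  fixes \<alpha> \<epsilon> \<eta> :: real
  assumes \<alpha>: "0 < \<alpha>" "\<alpha> < 1" and \<epsilon>: "0 < \<epsilon>" and \<eta>: "0 \<le> \<eta>"
  shows "(\<integral>\<^sup>+s. ennreal (exp (- (\<eta> * s)) * shifted_density \<alpha> \<epsilon> s) * indicator {\<epsilon>..} s \<partial>lborel)
    = ennreal (\<alpha> / \<epsilon> powr \<alpha> * (Gamma \<alpha> - lower_incomplete_gamma \<alpha> (\<eta> * \<epsilon>)))"
proof -
  define c where "c = \<alpha> / Gamma (1 - \<alpha>)"
  have G: "0 < Gamma (1 - \<alpha>)" using \<alpha> by (intro Gamma_real_pos) simp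
  then have G0: "Gamma (1 - \<alpha>) \<noteq> 0" by simp
  with G have c: "0 < c" "c * Gamma (1 - \<alpha>) = \<alpha>" using \<alpha> by (simp_all add: c_def)
  have "(\<integral>\<^sup>+s. ennreal (exp (- (\<eta> * s)) * shifted_density \<alpha> \<epsilon> s) * indicator {\<epsilon>..} s \<partial>lborel)
     = (\<integral>\<^sup>+s. (\<integral>\<^sup>+w. ennreal (c * ((s - \<epsilon>) powr (- \<alpha>) * exp (- (w * s)))) * indicator {\<epsilon>..} s * indicator {\<eta>..} w \<partial>lborel) \<partial>lborel)"
  proof (rule nn_integral_cong)
    fix s :: real
    show "ennreal (exp (- (\<eta> * s)) * shifted_density \<alpha> \<epsilon> s) * indicator {\<epsilon>..} s
      = (\<integral>\<^sup>+w. ennreal (c * ((s - \<epsilon>) powr (- \<alpha>) * exp (- (w * s)))) * indicator {\<epsilon>..} s * indicator {\<eta>..} w \<partial>lborel)"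
    proof (cases "\<epsilon> \<le> s")
      case True
      with \<epsilon> have s: "0 < s" by simp
      have "(\<integral>\<^sup>+w. ennreal (c * ((s - \<epsilon>) powr (- \<alpha>) * exp (- (w * s)))) * indicator {\<epsilon>..} s * indicator {\<eta>..} w \<partial>lborel)
         = (\<integral>\<^sup>+w. ennreal (c * (s - \<epsilon>) powr (- \<alpha>)) * (ennreal (exp (- (w * s))) * indicator {\<eta>..} w) \<partial>lborel)"
        using True c by (intro nn_integral_cong) (auto simp: ennreal_mult'[symmetric] mult.assoc split: split_indicator)
      also have "\<dots> = ennreal (c * (s - \<epsilon>) powr (- \<alpha>)) * ennreal (exp (- (\<eta> * s)) / s)"
        by (subst nn_integral_cmult) (auto simp: nn_integral_exp_atLeast[OF s])
      also have "\<dots> = ennreal (exp (- (\<eta> * s)) * shifted_density \<alpha> \<epsilon> s) * indicator {\<epsilon>..} s"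
        using True s c by (simp add: ennreal_mult'[symmetric] shifted_density_def c_def powr_minus divide_inverse mult_ac)
      finally show ?thesis ..
    qed simp
  qed
  also have "\<dots> = (\<integral>\<^sup>+w. (\<integral>\<^sup>+s. ennreal (c * ((s - \<epsilon>) powr (- \<alpha>) * exp (- (w * s)))) * indicator {\<epsilon>..} s * indicator {\<eta>..} w \<partial>lborel) \<partial>lborel)"
    by (rule lborel_pair.Fubini') (simp add: case_prod_unfold)
  also have "\<dots> = (\<integral>\<^sup>+w. ennreal \<alpha> * (ennreal ((w - 0) powr (\<alpha> - 1) * exp (- (\<epsilon> * w))) * indicator {\<eta>..} w) \<partial>lborel)"
  \<comment> \<open>The point w = 0 lies in the range if \<eta> = 0. There the integral over s
    diverges, whereas the right-hand side is 0 because \<open>0 powr\<close> is 0, so this null set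
    is left out.\<close>
  proof (rule nn_integral_cong_AE, rule AE_mp[OF AE_lborel_singleton[of 0]], rule AE_I2, rule impI)
    fix w :: real assume "w \<noteq> 0"
    show "(\<integral>\<^sup>+s. ennreal (c * ((s - \<epsilon>) powr (- \<alpha>) * exp (- (w * s)))) * indicator {\<epsilon>..} s * indicator {\<eta>..} w \<partial>lborel)
      = ennreal \<alpha> * (ennreal ((w - 0) powr (\<alpha> - 1) * exp (- (\<epsilon> * w))) * indicator {\<eta>..} w)"
    proof (cases "\<eta> \<le> w")
      case True
      with \<open>w \<noteq> 0\<close> \<eta> have w: "0 < w" by simp
      have "(\<integral>\<^sup>+s. ennreal (c * ((s - \<epsilon>) powr (- \<alpha>) * exp (- (w * s)))) * indicator {\<epsilon>..} s * indicator {\<eta>..} w \<partial>lborel)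
        = (\<integral>\<^sup>+s. ennreal c * (ennreal ((s - \<epsilon>) powr ((1 - \<alpha>) - 1) * exp (- (w * s))) * indicator {\<epsilon>..} s) \<partial>lborel)"
        using True c by (intro nn_integral_cong) (auto simp: ennreal_mult'[symmetric] split: split_indicator)
      also have "\<dots> = ennreal c * ennreal (Gamma (1 - \<alpha>) * w powr (- (1 - \<alpha>)) * exp (- (w * \<epsilon>)))"
        using \<alpha> w nn_integral_gamma_shift[of "1 - \<alpha>" w \<epsilon>] by (subst nn_integral_cmult) auto
      also have "\<dots> = ennreal ((c * Gamma (1 - \<alpha>)) * (w powr (\<alpha> - 1) * exp (- (\<epsilon> * w))))"
      proof -
        have "c * (Gamma (1 - \<alpha>) * w powr (- (1 - \<alpha>)) * exp (- (w * \<epsilon>)))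
            = (c * Gamma (1 - \<alpha>)) * (w powr (\<alpha> - 1) * exp (- (\<epsilon> * w)))" by (simp add: mult_ac)
        with c(1) show ?thesis by (metis ennreal_mult' less_imp_le)
      qed
      finally show ?thesis using True \<alpha> unfolding c(2) by (simp add: ennreal_mult')
    qed simp
  qed
  \<comment> \<open>The substitution w = v / \<epsilon> moves the lower limit to \<eta> \<epsilon>;
    together with the Jacobian it yields the factor \<epsilon>^(-\<alpha>).\<close>
  also have "\<dots> = ennreal \<alpha> * (ennreal \<bar>1 / \<epsilon>\<bar> * (\<integral>\<^sup>+v. ennreal ((0 + 1 / \<epsilon> * v - 0) powr (\<alpha> - 1) * exp (- (\<epsilon> * (0 + 1 / \<epsilon> * v)))) * indicator {\<eta>..} (0 + 1 / \<epsilon> * v) \<partial>lborel))"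
    using \<epsilon> by (subst nn_integral_cmult, simp, subst nn_integral_real_affine[where t=0 and c="1 / \<epsilon>"]) auto
  also have "(\<integral>\<^sup>+v. ennreal ((0 + 1 / \<epsilon> * v - 0) powr (\<alpha> - 1) * exp (- (\<epsilon> * (0 + 1 / \<epsilon> * v)))) * indicator {\<eta>..} (0 + 1 / \<epsilon> * v) \<partial>lborel)
     = (\<integral>\<^sup>+v. ennreal (\<epsilon> powr (1 - \<alpha>)) * (ennreal (v powr (\<alpha> - 1) * exp (- v)) * indicator {\<eta> * \<epsilon>..} v) \<partial>lborel)"
  proof (rule nn_integral_cong)
    fix v :: real
    have "\<eta> \<le> v / \<epsilon> \<longleftrightarrow> \<eta> * \<epsilon> \<le> v" using \<epsilon> by (simp add: field_simps)
    moreover have "(v / \<epsilon>) powr (\<alpha> - 1) = \<epsilon> powr (1 - \<alpha>) * v powr (\<alpha> - 1)" if "\<eta> * \<epsilon> \<le> v"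
    proof -
      from that have "0 \<le> v" using \<epsilon> \<eta> by (meson mult_nonneg_nonneg less_imp_le order_trans)
      with \<epsilon> powr_minus_divide[of \<epsilon> "\<alpha> - 1"] show ?thesis by (simp add: powr_divide)
    qed
    ultimately show "ennreal ((0 + 1 / \<epsilon> * v - 0) powr (\<alpha> - 1) * exp (- (\<epsilon> * (0 + 1 / \<epsilon> * v)))) * indicator {\<eta>..} (0 + 1 / \<epsilon> * v)
      = ennreal (\<epsilon> powr (1 - \<alpha>)) * (ennreal (v powr (\<alpha> - 1) * exp (- v)) * indicator {\<eta> * \<epsilon>..} v)"
      using \<epsilon> by (auto simp: ennreal_mult'[symmetric] mult.assoc split: split_indicator)
  qed
  also have "\<dots> = ennreal (\<epsilon> powr (1 - \<alpha>)) * ennreal (Gamma \<alpha> - lower_incomplete_gamma \<alpha> (\<eta> * \<epsilon>))"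
    using \<alpha> \<epsilon> \<eta> by (subst nn_integral_cmult) (auto simp: nn_integral_upper_incomplete_gamma)
  also have "ennreal \<alpha> * (ennreal \<bar>1 / \<epsilon>\<bar> * \<dots>)
    = ennreal (\<alpha> * (\<bar>1 / \<epsilon>\<bar> * (\<epsilon> powr (1 - \<alpha>) * (Gamma \<alpha> - lower_incomplete_gamma \<alpha> (\<eta> * \<epsilon>)))))"
    using \<alpha> \<epsilon> \<eta> nn_integral_upper_incomplete_gamma(2)[of \<alpha> "\<eta> * \<epsilon>"] by (simp add: ennreal_mult' del: times_divide_eq_left times_divide_eq_right divide_eq_0_iff)
  also have "\<alpha> * (\<bar>1 / \<epsilon>\<bar> * (\<epsilon> powr (1 - \<alpha>) * (Gamma \<alpha> - lower_incomplete_gamma \<alpha> (\<eta> * \<epsilon>))))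
     = \<alpha> / \<epsilon> powr \<alpha> * (Gamma \<alpha> - lower_incomplete_gamma \<alpha> (\<eta> * \<epsilon>))"
    using \<epsilon> by (simp add: powr_diff field_simps)
  finally show ?thesis .
qed

lemma stable_density_measurable [measurable]: "stable_density \<alpha> \<in> borel_measurable borel"
  unfolding stable_density_def by measurable

lemma lower_incomplete_gamma_0: "lower_incomplete_gamma \<alpha> 0 = 0"
proof -
  have "lower_incomplete_gamma \<alpha> 0 = (\<integral>w. 0 \<partial>(lborel :: real measure))"
    unfolding lower_incomplete_gamma_def set_lebesgue_integral_def
    by (intro integral_cong_AE eventually_mono[OF AE_lborel_singleton[of 0]]) auto
  then show ?thesis by simp
qed

lemma shifted_density_integral_exp:
  fixes \<alpha> \<epsilon> \<eta> :: real
  assumes \<alpha>: "0 < \<alpha>" "\<alpha> < 1" and \<epsilon>: "0 < \<epsilon>" and \<eta>: "0 \<le> \<eta>"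
  shows "has_bochner_integral lborel (\<lambda>s. indicator {\<epsilon>..} s * shifted_density \<alpha> \<epsilon> s * exp (- (\<eta> * s)))
     (\<alpha> / \<epsilon> powr \<alpha> * (Gamma \<alpha> - lower_incomplete_gamma \<alpha> (\<eta> * \<epsilon>)))"
proof (rule has_bochner_integral_nn_integral)
  show "(\<integral>\<^sup>+s. ennreal (indicator {\<epsilon>..} s * shifted_density \<alpha> \<epsilon> s * exp (- (\<eta> * s))) \<partial>lborel)
      = ennreal (\<alpha> / \<epsilon> powr \<alpha> * (Gamma \<alpha> - lower_incomplete_gamma \<alpha> (\<eta> * \<epsilon>)))"
    using nn_integral_exp_shifted_density[OF assms, symmetric]
    by (auto intro!: nn_integral_cong simp: mult.commute split: split_indicator)
qed (use assms shifted_density_nonneg[OF \<alpha>] nn_integral_upper_incomplete_gamma(2)[of \<alpha> "\<eta> * \<epsilon>"] in \<open>auto split: split_indicator\<close>)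

lemma shifted_density_mass:
  fixes \<alpha> \<epsilon> :: real
  assumes "0 < \<alpha>" "\<alpha> < 1" "0 < \<epsilon>"
  shows "has_bochner_integral lborel (\<lambda>s. indicator {\<epsilon>..} s * shifted_density \<alpha> \<epsilon> s) (\<alpha> / \<epsilon> powr \<alpha> * Gamma \<alpha>)"
  using shifted_density_integral_exp[OF assms order_refl] by (simp add: lower_incomplete_gamma_0)

section \<open>Distance between the shifted and the stable density\<close>

lemma nn_integral_powr_shift:
  fixes \<alpha> \<epsilon> b :: real
  assumes "\<alpha> < 1" "0 \<le> \<epsilon>"
  shows "(\<integral>\<^sup>+s. ennreal ((s - b) powr (- \<alpha>)) * indicator {b..b + \<epsilon>} s \<partial>lborel) = ennreal (\<epsilon> powr (1 - \<alpha>) / (1 - \<alpha>))"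
proof -
  have "(\<integral>\<^sup>+s. ennreal ((s - b) powr (- \<alpha>)) * indicator {b..b + \<epsilon>} s \<partial>lborel)
     = ennreal \<bar>1\<bar> * (\<integral>\<^sup>+s. ennreal ((b + 1 * s - b) powr (- \<alpha>)) * indicator {b..b + \<epsilon>} (b + 1 * s) \<partial>lborel)"
    by (intro nn_integral_real_affine) auto
  also have "\<dots> = (\<integral>\<^sup>+s. ennreal (indicator {0..\<epsilon>} s * s powr (- \<alpha>)) \<partial>lborel)"
    by (auto intro!: nn_integral_cong split: split_indicator)
  also have "\<dots> = ennreal (\<epsilon> powr (1 - \<alpha>) / (1 - \<alpha>))"
    using nn_integral_has_integral_lebesgue[OF _ has_integral_powr_from_0[of "- \<alpha>" \<epsilon>]] assms by simp
  finally show ?thesis .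
qed

text \<open>Both densities are compared after multiplication by \<open>s\<close>, since \<open>\<bar>T s h x - h x\<bar> \<le> C * s\<close>.\<close>

definition density_gap :: "real \<Rightarrow> real \<Rightarrow> real \<Rightarrow> real" where
  "density_gap \<alpha> \<epsilon> s = indicator {0<..} s * (s * \<bar>indicator {\<epsilon>..} s * shifted_density \<alpha> \<epsilon> s - stable_density \<alpha> s\<bar>)"

lemma density_gap_measurable [measurable]: "density_gap \<alpha> \<epsilon> \<in> borel_measurable borel"
  unfolding density_gap_def by measurable

lemma density_gap_nonneg: "0 \<le> density_gap \<alpha> \<epsilon> s"
  by (auto simp: density_gap_def split: split_indicator)

text \<open>Neither power is integrable at infinity, but the difference decays like \<alpha>
  \<epsilon> s^(-\<alpha> - 1). Correspondingly, the two terms of the antiderivative are unbounded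
  while their difference tends to 0. Starting at 2\<epsilon> keeps clear of the singularity at
  \<epsilon>.\<close>

lemma powr_diff_tail:
  fixes \<alpha> \<epsilon> :: real
  assumes \<alpha>: "0 < \<alpha>" "\<alpha> < 1" and \<epsilon>: "0 < \<epsilon>"
  shows "(\<integral>\<^sup>+s. ennreal ((s - \<epsilon>) powr (- \<alpha>) - s powr (- \<alpha>)) * indicator {2 * \<epsilon>..} s \<partial>lborel)
     = ennreal (((2 * \<epsilon>) powr (1 - \<alpha>) - \<epsilon> powr (1 - \<alpha>)) / (1 - \<alpha>))"
proof -
  let ?F = "\<lambda>s. ((s - \<epsilon>) powr (1 - \<alpha>) - s powr (1 - \<alpha>)) / (1 - \<alpha>)"
  have "(?F \<longlongrightarrow> 0) at_top"
    using assms by real_asymp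
  then have "(\<integral>\<^sup>+s. ennreal ((s - \<epsilon>) powr (- \<alpha>) - s powr (- \<alpha>)) * indicator {2 * \<epsilon>..} s \<partial>lborel) = ennreal (0 - ?F (2 * \<epsilon>))"
  proof (rule nn_integral_FTC_atLeast[rotated 3])
    fix x assume x: "2 * \<epsilon> \<le> x"
    with \<epsilon> have "0 < x - \<epsilon>" "0 < x" by simp_all
    with \<alpha> show "(?F has_real_derivative (x - \<epsilon>) powr (- \<alpha>) - x powr (- \<alpha>)) (at x)"
      by (auto intro!: derivative_eq_intros simp: right_diff_distrib[symmetric])
    show "0 \<le> (x - \<epsilon>) powr (- \<alpha>) - x powr (- \<alpha>)"
      using \<open>0 < x - \<epsilon>\<close> \<epsilon> \<alpha> by (simp add: powr_mono2')
  qed simp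
  also have "0 - ?F (2 * \<epsilon>) = ((2 * \<epsilon>) powr (1 - \<alpha>) - \<epsilon> powr (1 - \<alpha>)) / (1 - \<alpha>)"
    using \<alpha> by (simp add: field_simps)
  finally show ?thesis .
qed

text \<open>Multiplied by s, the densities become multiples of s^(-\<alpha>) and (s -
  \<epsilon>)^(-\<alpha>). Below \<epsilon> only the first is present; between \<epsilon> and
  2\<epsilon> the second is the larger one and bounds the difference; beyond 2\<epsilon> the
  cancellation of \<open>powr_diff_tail\<close> is needed. Two contributions \<epsilon>^(1 -
  \<alpha>) and one (2\<epsilon>)^(1 - \<alpha>) - \<epsilon>^(1 - \<alpha>) add up to the
  bound.\<close>

lemma density_gap_integral:
  fixes \<alpha> \<epsilon> :: real
  assumes \<alpha>: "0 < \<alpha>" "\<alpha> < 1" and \<epsilon>: "0 < \<epsilon>"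
  shows "integrable lborel (density_gap \<alpha> \<epsilon>)"
    and "(\<integral>s. density_gap \<alpha> \<epsilon> s \<partial>lborel) \<le> \<alpha> / Gamma (1 - \<alpha>) * (\<epsilon> powr (1 - \<alpha>) + (2 * \<epsilon>) powr (1 - \<alpha>)) / (1 - \<alpha>)"
proof -
  define c where "c = \<alpha> / Gamma (1 - \<alpha>)"
  have c: "0 \<le> c" using \<alpha> by (auto simp: c_def intro!: divide_nonneg_nonneg Gamma_real_nonneg)
  let ?b = "\<lambda>s. ennreal ((s - 0) powr (- \<alpha>)) * indicator {0..0 + \<epsilon>} s
      + ennreal ((s - \<epsilon>) powr (- \<alpha>)) * indicator {\<epsilon>..\<epsilon> + \<epsilon>} s
      + ennreal ((s - \<epsilon>) powr (- \<alpha>) - s powr (- \<alpha>)) * indicator {2 * \<epsilon>..} s"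
  let ?B = "\<alpha> / Gamma (1 - \<alpha>) * (\<epsilon> powr (1 - \<alpha>) + (2 * \<epsilon>) powr (1 - \<alpha>)) / (1 - \<alpha>)"
  have gap: "density_gap \<alpha> \<epsilon> s = c * \<bar>indicator {\<epsilon>..} s * (s - \<epsilon>) powr (- \<alpha>) - s powr (- \<alpha>)\<bar>" if "0 < s" for s
  proof -
    have "shifted_density \<alpha> \<epsilon> s = c * ((s - \<epsilon>) powr (- \<alpha>) / s)" "stable_density \<alpha> s = c * (s powr (- \<alpha>) / s)"
      using that by (simp_all add: shifted_density_def stable_density_def c_def powr_minus_divide powr_diff)
    then have "s * (indicator {\<epsilon>..} s * shifted_density \<alpha> \<epsilon> s - stable_density \<alpha> s)
        = c * (indicator {\<epsilon>..} s * (s - \<epsilon>) powr (- \<alpha>) - s powr (- \<alpha>))"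
      using that by (simp add: field_simps)
    then have "\<bar>s * (indicator {\<epsilon>..} s * shifted_density \<alpha> \<epsilon> s - stable_density \<alpha> s)\<bar>
        = \<bar>c * (indicator {\<epsilon>..} s * (s - \<epsilon>) powr (- \<alpha>) - s powr (- \<alpha>))\<bar>" by simp
    with that c show ?thesis by (simp add: density_gap_def abs_mult)
  qed
  have pointwise: "ennreal (density_gap \<alpha> \<epsilon> s) \<le> ennreal c * ?b s" for s
  proof -
    consider "s \<le> 0" | "0 < s" "s < \<epsilon>" | "s = \<epsilon>" | "\<epsilon> < s" "s < 2 * \<epsilon>" | "2 * \<epsilon> \<le> s" by linarith
    then show ?thesis
    proof cases
      case 1 then show ?thesis by (simp add: density_gap_def)
    next
      case 2
      with c show ?thesis by (simp add: gap ennreal_mult')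
    next
      \<comment> \<open>At s = \<epsilon> the shifted density is 0 because \<open>0 powr\<close> is
        0. The remaining stable term is covered by the first summand of \<open>?b\<close>, whose
        interval is closed.\<close>
      case 3
      with c \<epsilon> show ?thesis by (simp add: gap ennreal_mult')
    next
      case 4
      have "s powr (- \<alpha>) \<le> (s - \<epsilon>) powr (- \<alpha>)" using 4 \<epsilon> \<alpha> by (simp add: powr_mono2')
      then have "density_gap \<alpha> \<epsilon> s \<le> c * (s - \<epsilon>) powr (- \<alpha>)"
        using 4 \<epsilon> c by (simp add: gap mult_left_mono)
      then have "ennreal (density_gap \<alpha> \<epsilon> s) \<le> ennreal c * ennreal ((s - \<epsilon>) powr (- \<alpha>))"
        using c by (simp add: ennreal_mult'[symmetric] ennreal_leI)
      with 4 \<epsilon> show ?thesis by simp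
    next
      case 5
      have "s powr (- \<alpha>) \<le> (s - \<epsilon>) powr (- \<alpha>)" using 5 \<epsilon> \<alpha> by (simp add: powr_mono2')
      with 5 \<epsilon> c have "ennreal (density_gap \<alpha> \<epsilon> s) = ennreal c * ennreal ((s - \<epsilon>) powr (- \<alpha>) - s powr (- \<alpha>))"
        by (simp add: gap ennreal_mult'[symmetric])
      also have "\<dots> \<le> ennreal c * ?b s"
        using 5 by (intro mult_left_mono) auto
      finally show ?thesis .
    qed
  qed
  have "(\<integral>\<^sup>+s. ennreal (density_gap \<alpha> \<epsilon> s) \<partial>lborel) \<le> (\<integral>\<^sup>+s. ennreal c * ?b s \<partial>lborel)"
    by (intro nn_integral_mono pointwise)
  also have "\<dots> = ennreal c * (\<integral>\<^sup>+s. ?b s \<partial>lborel)"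
    by (rule nn_integral_cmult) measurable
  also have "(\<integral>\<^sup>+s. ?b s \<partial>lborel) = ennreal (\<epsilon> powr (1 - \<alpha>) / (1 - \<alpha>)) + ennreal (\<epsilon> powr (1 - \<alpha>) / (1 - \<alpha>))
      + ennreal (((2 * \<epsilon>) powr (1 - \<alpha>) - \<epsilon> powr (1 - \<alpha>)) / (1 - \<alpha>))"
    using assms by (subst nn_integral_add, simp, simp, subst nn_integral_add, simp, simp)
      (simp only: nn_integral_powr_shift powr_diff_tail less_imp_le)
  also have "\<dots> = ennreal ((\<epsilon> powr (1 - \<alpha>) + (2 * \<epsilon>) powr (1 - \<alpha>)) / (1 - \<alpha>))"
  proof -
    have "\<epsilon> powr (1 - \<alpha>) \<le> (2 * \<epsilon>) powr (1 - \<alpha>)" using assms by (intro powr_mono2) auto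
    then show ?thesis
      using \<alpha> by (simp add: ennreal_plus[symmetric] add_divide_distrib[symmetric] del: ennreal_plus)
  qed
  also have "ennreal c * \<dots> = ennreal ?B"
    using c by (simp add: ennreal_mult'[symmetric] c_def)
  finally have bound: "(\<integral>\<^sup>+s. ennreal (density_gap \<alpha> \<epsilon> s) \<partial>lborel) \<le> ennreal ?B" .
  then show int: "integrable lborel (density_gap \<alpha> \<epsilon>)"
    by (intro integrableI_bounded) (auto simp: density_gap_nonneg intro: order_le_less_trans)
  have "0 \<le> ?B" using \<alpha> c by (auto simp: c_def intro!: divide_nonneg_nonneg)
  with bound int show "(\<integral>s. density_gap \<alpha> \<epsilon> s \<partial>lborel) \<le> ?B"
    by (simp add: nn_integral_eq_integral density_gap_nonneg)
qed

section \<open>Compound Poisson laws\<close>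

text \<open>The expectation of a(K) for K Poisson with parameter z, given as a power series: this
  makes sense at z = 0, that is at time 0, and can be differentiated term by term.\<close>

definition poisson_mean :: "(nat \<Rightarrow> real) \<Rightarrow> real \<Rightarrow> real" where
  "poisson_mean a z = exp (- z) * (\<Sum>n. a n / fact n * z ^ n)"

lemma summable_poisson:
  fixes a :: "nat \<Rightarrow> real"
  assumes "\<And>n. \<bar>a n\<bar> \<le> C"
  shows "summable (\<lambda>n. a n / fact n * z ^ n)" "summable (\<lambda>n. \<bar>a n / fact n * z ^ n\<bar>)"
proof -
  have s: "summable (\<lambda>n. C * (inverse (fact n) * \<bar>z\<bar> ^ n))"
    by (intro summable_mult summable_exp)
  have le: "\<bar>a n / fact n * z ^ n\<bar> \<le> C * (inverse (fact n) * \<bar>z\<bar> ^ n)" for n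
    using mult_right_mono[OF assms[of n], of "inverse (fact n) * \<bar>z\<bar> ^ n"]
    by (simp add: abs_mult power_abs divide_inverse mult.assoc)
  show "summable (\<lambda>n. \<bar>a n / fact n * z ^ n\<bar>)"
    by (rule summable_comparison_test'[OF s]) (use le in auto)
  then show "summable (\<lambda>n. a n / fact n * z ^ n)" by (rule summable_rabs_cancel)
qed

lemma poisson_mean_0: "poisson_mean a 0 = a 0"
  unfolding poisson_mean_def using powser_zero[of "\<lambda>n. a n / fact n"] by simp

text \<open>The probability generating function of a Poisson law. With c the Laplace transform of a
  single jump it is the transform of the compound Poisson law.\<close>

lemma poisson_mean_power: "poisson_mean (\<lambda>n. c ^ n) z = exp (z * (c - 1))"
proof -
  have "(\<Sum>n. c ^ n / fact n * z ^ n) = exp (z * c)"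
    unfolding exp_def by (intro suminf_cong) (simp add: power_mult_distrib divide_inverse mult_ac)
  then show ?thesis by (simp add: poisson_mean_def exp_add[symmetric] algebra_simps)
qed

lemma poisson_mean_bound:
  assumes "\<And>n. \<bar>a n\<bar> \<le> C" "0 \<le> z"
  shows "\<bar>poisson_mean a z\<bar> \<le> C"
proof -
  have le: "\<bar>a n / fact n * z ^ n\<bar> \<le> C * (inverse (fact n) * z ^ n)" for n
    using mult_right_mono[OF assms(1)[of n], of "inverse (fact n) * z ^ n"] assms(2)
    by (simp add: abs_mult power_abs divide_inverse mult.assoc)
  have "\<bar>\<Sum>n. a n / fact n * z ^ n\<bar> \<le> (\<Sum>n. \<bar>a n / fact n * z ^ n\<bar>)"
    by (rule summable_rabs[OF summable_poisson(2)[of a C, OF assms(1)]])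
  also have "\<dots> \<le> (\<Sum>n. C * (inverse (fact n) * z ^ n))"
    by (intro suminf_le le summable_poisson(2)[of a C, OF assms(1)] summable_mult summable_exp)
  also have "\<dots> = C * exp z"
    by (subst suminf_mult) (auto simp: exp_def divide_inverse intro: summable_exp)
  finally have "exp (- z) * \<bar>\<Sum>n. a n / fact n * z ^ n\<bar> \<le> exp (- z) * (C * exp z)"
    by (intro mult_left_mono) auto
  then show ?thesis by (simp add: poisson_mean_def abs_mult exp_minus field_simps)
qed

lemma poisson_mean_diff:
  assumes "\<And>n. \<bar>a n\<bar> \<le> C" "\<And>n. \<bar>b n\<bar> \<le> D"
  shows "poisson_mean (\<lambda>n. a n - b n) z = poisson_mean a z - poisson_mean b z"
proof -
  have "(\<Sum>n. a n / fact n * z ^ n) - (\<Sum>n. b n / fact n * z ^ n) = (\<Sum>n. (a n - b n) / fact n * z ^ n)"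
    by (subst suminf_diff[OF summable_poisson(1)[of a C, OF assms(1)] summable_poisson(1)[of b D, OF assms(2)]])
       (simp add: algebra_simps diff_divide_distrib)
  then show ?thesis by (simp add: poisson_mean_def right_diff_distrib[symmetric])
qed

text \<open>Differentiating the series shifts the coefficients, differentiating exp(-z) subtracts
  the original mean. The derivative is again a Poisson mean, so bounds on coefficients pass to
  derivatives of any order.\<close>

lemma poisson_mean_deriv:
  assumes "\<And>n. \<bar>a n\<bar> \<le> C"
  shows "(poisson_mean a has_real_derivative poisson_mean (\<lambda>n. a (Suc n) - a n) z) (at z)"
proof -
  have "((\<lambda>z. \<Sum>n. a n / fact n * z ^ n) has_real_derivative (\<Sum>n. diffs (\<lambda>n. a n / fact n) n * z ^ n)) (at z)"
    by (rule termdiffs_strong_converges_everywhere) (rule summable_poisson(1)[of a C, OF assms])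
  moreover have "diffs (\<lambda>n. a n / fact n) n = a (Suc n) / fact n" for n
    by (simp add: diffs_def del: of_nat_Suc)
  ultimately have d: "((\<lambda>z. \<Sum>n. a n / fact n * z ^ n) has_real_derivative (\<Sum>n. a (Suc n) / fact n * z ^ n)) (at z)"
    by (simp only:)
  have "((\<lambda>z. exp (- z) * (\<Sum>n. a n / fact n * z ^ n)) has_real_derivative
      (poisson_mean (\<lambda>n. a (Suc n)) z - poisson_mean a z)) (at z)"
  proof (rule DERIV_cong[OF DERIV_mult[OF _ d]])
    show "((\<lambda>z. exp (- z)) has_real_derivative - exp (- z)) (at z)"
      by (auto intro!: derivative_eq_intros)
  qed (simp add: poisson_mean_def)
  then show ?thesis
    using poisson_mean_diff[of "\<lambda>n. a (Suc n)" C a C z] assms by (simp add: poisson_mean_def[abs_def])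
qed

lemma poisson_mean_lipschitz:
  assumes "\<And>n. \<bar>a n\<bar> \<le> C" "0 \<le> r" "0 \<le> t"
  shows "\<bar>poisson_mean a r - poisson_mean a t\<bar> \<le> 2 * C * \<bar>r - t\<bar>"
proof -
  have d: "\<bar>a (Suc n) - a n\<bar> \<le> 2 * C" for n
    using assms(1)[of n] assms(1)[of "Suc n"] by linarith
  have "norm (poisson_mean a r - poisson_mean a t) \<le> 2 * C * norm (r - t)"
    by (rule field_differentiable_bound[where S="{0..}" and f'="poisson_mean (\<lambda>n. a (Suc n) - a n)"])
       (use assms poisson_mean_bound[of "\<lambda>n. a (Suc n) - a n", OF d]
       in \<open>auto intro: has_field_derivative_at_within poisson_mean_deriv[of a C, OF assms(1)]\<close>)
  then show ?thesis by simp
qed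

text \<open>By the mean value theorem the increment is (r - t) times the derivative at an
  intermediate point. The derivative has coefficients bounded by 2C and is therefore Lipschitz with
  constant 2 * (2C). The remainder depends on the sequence only through C, which later makes it
  uniform in x; both orders of r and t occur because the derivative is two-sided for t > 0.\<close>

lemma poisson_mean_taylor:
  assumes a: "\<And>n. \<bar>a n\<bar> \<le> C" and "0 \<le> r" "0 \<le> t"
  shows "\<bar>poisson_mean a r - poisson_mean a t - (r - t) * poisson_mean (\<lambda>n. a (Suc n) - a n) t\<bar> \<le> 4 * C * (r - t)\<^sup>2"
proof (cases "r = t")
  case False
  let ?D = "poisson_mean (\<lambda>n. a (Suc n) - a n)"
  have d: "\<bar>a (Suc n) - a n\<bar> \<le> 2 * C" for n
    using a[of n] a[of "Suc n"] by linarith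
  have "\<exists>\<xi>. min r t \<le> \<xi> \<and> \<xi> \<le> max r t \<and> poisson_mean a r - poisson_mean a t = (r - t) * ?D \<xi>"
  proof (cases "r < t")
    case True
    obtain z where "r < z" "z < t" "poisson_mean a t - poisson_mean a r = (t - r) * ?D z"
      using MVT2[OF True, of "poisson_mean a" ?D] poisson_mean_deriv[of a C, OF a] by blast
    then show ?thesis using True by (intro exI[of _ z]) (auto simp: algebra_simps)
  next
    case rt: False
    with False have "t < r" by simp
    then obtain z where "t < z" "z < r" "poisson_mean a r - poisson_mean a t = (r - t) * ?D z"
      using MVT2[of t r "poisson_mean a" ?D] poisson_mean_deriv[of a C, OF a] by blast
    then show ?thesis using rt by (intro exI[of _ z]) (auto simp: algebra_simps)
  qed
  then obtain \<xi> where \<xi>: "min r t \<le> \<xi>" "\<xi> \<le> max r t" "poisson_mean a r - poisson_mean a t = (r - t) * ?D \<xi>"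
    by blast
  have C: "0 \<le> C" using a[of 0] by linarith
  have "\<bar>?D \<xi> - ?D t\<bar> \<le> 2 * (2 * C) * \<bar>\<xi> - t\<bar>"
    using \<xi> assms by (intro poisson_mean_lipschitz d) auto
  also have "\<dots> \<le> 2 * (2 * C) * \<bar>r - t\<bar>"
    using \<xi> C by (intro mult_left_mono) auto
  finally have "\<bar>r - t\<bar> * \<bar>?D \<xi> - ?D t\<bar> \<le> \<bar>r - t\<bar> * (2 * (2 * C) * \<bar>r - t\<bar>)"
    by (intro mult_left_mono) auto
  then have "\<bar>(r - t) * (?D \<xi> - ?D t)\<bar> \<le> 4 * C * (\<bar>r - t\<bar> * \<bar>r - t\<bar>)"
    by (simp only: abs_mult mult_ac)
  then show ?thesis
    unfolding \<xi>(3) by (simp add: right_diff_distrib power2_eq_square)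
qed simp

lemma integral_poisson_pmf:
  fixes a :: "nat \<Rightarrow> real"
  assumes "0 < z" "\<And>n. \<bar>a n\<bar> \<le> C"
  shows "(\<integral>n. a n \<partial>measure_pmf (poisson_pmf z)) = poisson_mean a z"
proof -
  have eq: "pmf (poisson_pmf z) n *\<^sub>R a n = exp (- z) * (a n / fact n * z ^ n)" for n
    using assms(1) by simp
  have i: "integrable (count_space UNIV) (\<lambda>n. pmf (poisson_pmf z) n *\<^sub>R a n)"
    unfolding integrable_count_space_nat_iff eq
    using summable_mult[OF summable_poisson(2)[of a C, OF assms(2)], of "exp (- z)" z] by (simp add: abs_mult)
  have "(\<integral>n. a n \<partial>measure_pmf (poisson_pmf z)) = (\<integral>n. pmf (poisson_pmf z) n *\<^sub>R a n \<partial>count_space UNIV)"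
    unfolding measure_pmf_eq_density by (rule integral_density) auto
  also have "\<dots> = (\<Sum>n. exp (- z) * (a n / fact n * z ^ n))"
    using integral_count_space_nat[OF i] by (simp only: eq)
  also have "\<dots> = poisson_mean a z"
    unfolding poisson_mean_def by (rule suminf_mult[OF summable_poisson(1)[of a C, OF assms(2)]])
  finally show ?thesis .
qed

section \<open>Convolution powers and their Laplace transforms\<close>

primrec conv_power :: "real measure \<Rightarrow> nat \<Rightarrow> real measure" where
  "conv_power N 0 = return borel 0"
| "conv_power N (Suc n) = convolution (conv_power N n) N"

lemma integral_convolution:
  fixes f :: "real \<Rightarrow> real"
  assumes "real_distribution M" "real_distribution N"
    and [measurable]: "f \<in> borel_measurable borel" and f: "\<And>x. \<bar>f x\<bar> \<le> B"
  shows "(\<integral>x. f x \<partial>convolution M N) = (\<integral>x. (\<integral>y. f (x + y) \<partial>N) \<partial>M)"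
proof -
  interpret M: real_distribution M by fact
  interpret N: real_distribution N by fact
  interpret P: pair_prob_space M N ..
  have "(\<integral>x. f x \<partial>convolution M N) = (\<integral>p. f (fst p + snd p) \<partial>(M \<Otimes>\<^sub>M N))"
    unfolding convolution_def by (subst integral_distr) (auto simp: case_prod_unfold)
  also have "\<dots> = (\<integral>x. (\<integral>y. f (x + y) \<partial>N) \<partial>M)"
    using f by (subst P.integral_fst'[symmetric])
      (auto intro!: P.integrable_const_bound[where B=B])
  finally show ?thesis .
qed

lemma real_distribution_convolution:
  assumes "real_distribution M" "real_distribution N"
  shows "real_distribution (convolution M N)"
proof -
  interpret M: real_distribution M by fact
  interpret N: real_distribution N by fact
  interpret P: pair_prob_space M N ..
  show ?thesis unfolding convolution_def
    by (rule P.real_distribution_distr) measurable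
qed

lemma real_distribution_return: "real_distribution (return borel (x::real))"
  by (auto simp: real_distribution_def real_distribution_axioms_def intro!: prob_space_return)

lemma real_distribution_conv_power:
  "real_distribution N \<Longrightarrow> real_distribution (conv_power N n)"
  by (induction n) (auto intro: real_distribution_return real_distribution_convolution)

lemma AE_convolution_nonneg:
  assumes "real_distribution M" "real_distribution N" "AE x in M. 0 \<le> x" "AE x in N. 0 \<le> x"
  shows "AE x in convolution M N. 0 \<le> (x::real)"
proof -
  interpret M: real_distribution M by fact
  interpret N: real_distribution N by fact
  interpret P: pair_prob_space M N ..
  have "AE p in M \<Otimes>\<^sub>M N. 0 \<le> fst p + snd p"
  proof (rule P.AE_pair_measure)
    show "{p \<in> space (M \<Otimes>\<^sub>M N). 0 \<le> fst p + snd p} \<in> sets (M \<Otimes>\<^sub>M N)" by measurable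
    show "AE x in M. AE y in N. 0 \<le> fst (x, y) + snd (x, y)"
      using assms(3)
    proof eventually_elim
      fix x :: real assume "0 \<le> x"
      then show "AE y in N. 0 \<le> fst (x, y) + snd (x, y)"
        using assms(4) by (auto elim!: eventually_mono)
    qed
  qed
  then show ?thesis
    unfolding convolution_def by (subst AE_distr_iff) (auto simp: case_prod_unfold)
qed

lemma AE_conv_power_nonneg:
  "real_distribution N \<Longrightarrow> AE x in N. 0 \<le> x \<Longrightarrow> AE x in conv_power N n. 0 \<le> x"
proof (induction n)
  case 0
  show ?case by (subst conv_power.simps, subst AE_return) auto
next
  case (Suc n)
  then show ?case
    unfolding conv_power.simps by (intro AE_convolution_nonneg real_distribution_conv_power)
qed

lemma laplace_convolution:
  assumes M: "real_distribution M" "AE x in M. 0 \<le> x" and N: "real_distribution N" "AE x in N. 0 \<le> x"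
    and \<eta>: "0 \<le> \<eta>"
  shows "(\<integral>x. exp (- \<eta> * x) \<partial>convolution M N) = (\<integral>x. exp (- \<eta> * x) \<partial>M) * (\<integral>x. exp (- \<eta> * x) \<partial>N)"
proof -
  interpret M: real_distribution M by fact
  interpret N: real_distribution N by fact
  \<comment> \<open>The exponential is unbounded on the line. The truncation is bounded by 1, as
    \<open>integral_convolution\<close> requires, and agrees with it almost everywhere for laws on
    the half-line.\<close>
  let ?f = "\<lambda>x::real. exp (- \<eta> * max x 0)"
  have "AE x in convolution M N. exp (- \<eta> * x) = ?f x"
    using AE_convolution_nonneg[OF M(1) N(1) M(2) N(2)] by eventually_elim (simp add: max_def)
  then have "(\<integral>x. exp (- \<eta> * x) \<partial>convolution M N) = (\<integral>x. ?f x \<partial>convolution M N)"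
    by (intro integral_cong_AE) auto
  also have "\<dots> = (\<integral>x. (\<integral>y. ?f (x + y) \<partial>N) \<partial>M)"
    using \<eta> by (intro integral_convolution[where B=1] M N) auto
  also have "\<dots> = (\<integral>x. exp (- \<eta> * x) * (\<integral>y. exp (- \<eta> * y) \<partial>N) \<partial>M)"
  proof (intro integral_cong_AE)
    show "AE x in M. (\<integral>y. ?f (x + y) \<partial>N) = exp (- \<eta> * x) * (\<integral>y. exp (- \<eta> * y) \<partial>N)"
      using M(2)
    proof eventually_elim
      fix x :: real assume x: "0 \<le> x"
      have "AE y in N. ?f (x + y) = exp (- \<eta> * x) * exp (- \<eta> * y)"
        using N(2) by eventually_elim (use x in \<open>simp add: max_absorb1 exp_add[symmetric] algebra_simps\<close>)
      then have "(\<integral>y. ?f (x + y) \<partial>N) = (\<integral>y. exp (- \<eta> * x) * exp (- \<eta> * y) \<partial>N)"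
        by (intro integral_cong_AE) auto
      then show "(\<integral>y. ?f (x + y) \<partial>N) = exp (- \<eta> * x) * (\<integral>y. exp (- \<eta> * y) \<partial>N)" by simp
    qed
  qed measurable
  finally show ?thesis by simp
qed

lemma laplace_conv_power:
  assumes "real_distribution N" "AE x in N. 0 \<le> x" "0 \<le> \<eta>"
  shows "(\<integral>x. exp (- \<eta> * x) \<partial>conv_power N n) = (\<integral>x. exp (- \<eta> * x) \<partial>N) ^ n"
proof (induction n)
  case 0
  show ?case by (simp add: integral_return)
next
  case (Suc n)
  with assms show ?case
    using laplace_convolution[of "conv_power N n" N \<eta>]
    by (simp add: AE_conv_power_nonneg real_distribution_conv_power mult.commute)
qed

text \<open>Transforms at integers are the moments of Y = exp(-x), which lies in (0, 1] almost
  surely. Expanding the characteristic function of Y in its exponential series, dominated by |t|^n /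
  n!, shows that these moments determine the law of Y; applying -ln recovers the law of x.\<close>

lemma real_distribution_eq_laplace:
  assumes P: "real_distribution P" "AE x in P. 0 \<le> x"
    and Q: "real_distribution Q" "AE x in Q. 0 \<le> x"
    and eq: "\<And>n::nat. (\<integral>x. exp (- real n * x) \<partial>P) = (\<integral>x. exp (- real n * x) \<partial>Q)"
  shows "P = Q"
proof -
  have char_sums: "(\<lambda>n. (\<i> * complex_of_real t) ^ n / fact n * complex_of_real (\<integral>x. exp (- real n * x) \<partial>R))
      sums char (distr R borel (\<lambda>x. exp (- x))) t"
    if R: "real_distribution R" "AE x in R. 0 \<le> x" for R t
  proof -
    interpret real_distribution R by fact
    let ?f = "\<lambda>n x. (\<i> * complex_of_real t) ^ n / fact n * complex_of_real (exp (- real n * x))"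
    have b: "AE x in R. norm (?f n x) \<le> \<bar>t\<bar> ^ n / fact n" for n
      using R(2) by eventually_elim
        (auto simp: norm_mult norm_divide norm_power intro!: divide_right_mono mult_left_le)
    have i: "integrable R (?f n)" for n
      by (rule integrable_const_bound[OF b]) measurable
    have s: "summable (\<lambda>n. \<bar>t\<bar> ^ n / fact n)"
      using summable_exp[of "\<bar>t\<bar>"] by (simp add: divide_inverse mult.commute)
    have "(\<lambda>n. \<integral>x. ?f n x \<partial>R) sums (\<integral>x. (\<Sum>n. ?f n x) \<partial>R)"
    proof (rule sums_integral)
      have "AE x in R. \<forall>n. norm (?f n x) \<le> \<bar>t\<bar> ^ n / fact n"
        using b by (simp add: AE_all_countable)
      then show "AE x in R. summable (\<lambda>n. norm (?f n x))"
        by eventually_elim (auto intro!: summable_comparison_test'[OF s])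
      show "summable (\<lambda>n. \<integral>x. norm (?f n x) \<partial>R)"
      proof (rule summable_comparison_test'[OF s])
        fix n
        have "(\<integral>x. norm (?f n x) \<partial>R) \<le> (\<integral>x. \<bar>t\<bar> ^ n / fact n \<partial>R)"
          using b i by (intro integral_mono_AE) auto
        then show "norm (\<integral>x. norm (?f n x) \<partial>R) \<le> \<bar>t\<bar> ^ n / fact n"
          using prob_space by simp
      qed
    qed (rule i)
    moreover have "(\<Sum>n. ?f n x) = iexp (t * exp (- x))" for x
    proof -
      have "?f n x = (\<i> * complex_of_real (t * exp (- x))) ^ n /\<^sub>R fact n" for n
      proof -
        have "exp (- real n * x) = exp (- x) ^ n" using exp_of_nat_mult[of n "- x"] by simp
        then show ?thesis by (simp add: power_mult_distrib scaleR_conv_of_real divide_inverse mult_ac)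
      qed
      then show ?thesis by (simp only: exp_def)
    qed
    moreover have "char (distr R borel (\<lambda>x. exp (- x))) t = (\<integral>x. iexp (t * exp (- x)) \<partial>R)"
      unfolding char_def by (subst integral_distr) auto
    moreover have "(\<integral>x. ?f n x \<partial>R) = (\<i> * complex_of_real t) ^ n / fact n * complex_of_real (\<integral>x. exp (- real n * x) \<partial>R)" for n
      by (simp only: integral_mult_right_zero integral_complex_of_real)
    ultimately show ?thesis by simp
  qed
  interpret P: real_distribution P by fact
  interpret Q: real_distribution Q by fact
  have "distr P borel (\<lambda>x. exp (- x)) = distr Q borel (\<lambda>x. exp (- x))"
  proof (rule Levy_uniqueness)
    show "char (distr P borel (\<lambda>x. exp (- x))) = char (distr Q borel (\<lambda>x. exp (- x)))"
    proof
      fix t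
      show "char (distr P borel (\<lambda>x. exp (- x))) t = char (distr Q borel (\<lambda>x. exp (- x))) t"
        using char_sums[OF P, of t] char_sums[OF Q, of t] unfolding eq by (rule sums_unique2)
    qed
  qed (auto intro!: P.real_distribution_distr Q.real_distribution_distr)
  then have "distr (distr P borel (\<lambda>x. exp (- x))) borel (\<lambda>y. - ln y)
      = distr (distr Q borel (\<lambda>x. exp (- x))) borel (\<lambda>y. - ln y)" by simp
  then have "distr P borel (\<lambda>x. x) = distr Q borel (\<lambda>x. x)"
    by (simp add: distr_distr comp_def)
  then show "P = Q"
    using distr_id2[of borel P] distr_id2[of borel Q] by (simp add: id_def)
qed

text \<open>The mixture \<open>?Q\<close> of the convolution powers with Poisson weights has the
  same transform as \<mu>, by \<open>poisson_mean_power\<close>, hence equals \<mu>. An integral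
  against the mixture is the Poisson mean of the integrals against the convolution powers.\<close>

lemma compound_poisson_expectation:
  fixes f :: "real \<Rightarrow> real"
  assumes N: "real_distribution N" "AE x in N. 0 \<le> x"
    and \<mu>: "real_distribution \<mu>" "AE x in \<mu>. 0 \<le> x"
    and z: "0 \<le> z"
    and laplace: "\<And>\<eta>. 0 \<le> \<eta> \<Longrightarrow> (\<integral>x. exp (- \<eta> * x) \<partial>\<mu>) = exp (z * ((\<integral>x. exp (- \<eta> * x) \<partial>N) - 1))"
    and f: "f \<in> borel_measurable borel" "\<And>x. \<bar>f x\<bar> \<le> B"
  shows "(\<integral>x. f x \<partial>\<mu>) = poisson_mean (\<lambda>n. \<integral>x. f x \<partial>conv_power N n) z"
proof (cases "z = 0")
  case True
  \<comment> \<open>The Poisson mixture below uses a positive parameter. For z = 0 all transforms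
    are 1, so \<mu> is the point mass at 0, the zeroth convolution power.\<close>
  have "\<mu> = return borel 0"
    by (rule real_distribution_eq_laplace[OF \<mu> real_distribution_return])
       (use laplace True in \<open>auto simp: AE_return integral_return\<close>)
  then show ?thesis using f(1) True by (simp add: poisson_mean_0 integral_return)
next
  case False
  with z have z: "0 < z" by simp
  let ?K = "conv_power N"
  have K: "real_distribution (?K n)" "AE x in ?K n. 0 \<le> x" for n
    using N by (auto intro: real_distribution_conv_power AE_conv_power_nonneg)
  have meas: "?K \<in> measure_pmf (poisson_pmf z) \<rightarrow>\<^sub>M subprob_algebra borel"
    using K(1) by (auto simp: space_subprob_algebra real_distribution_def real_distribution_axioms_def prob_space_imp_subprob_space)
  have prob: "AE n in measure_pmf (poisson_pmf z). prob_space (?K n)"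
    using K(1) by (auto simp: real_distribution_def)
  have mass: "emeasure (?K n) (space (?K n)) \<le> ennreal 1" for n
    using K(1)[of n] by (simp add: real_distribution_def prob_space.emeasure_space_1)
  let ?Q = "measure_pmf (poisson_pmf z) \<bind> ?K"
  have integral_Q: "(\<integral>x. g x \<partial>?Q) = poisson_mean (\<lambda>n. \<integral>x. g x \<partial>?K n) z"
    if g: "g \<in> borel_measurable borel" "\<And>x. \<bar>g x\<bar> \<le> D" for g :: "real \<Rightarrow> real" and D
  proof -
    have "\<bar>\<integral>x. g x \<partial>?K n\<bar> \<le> D" for n
    proof -
      interpret real_distribution "?K n" by (rule K)
      have "\<bar>\<integral>x. g x \<partial>?K n\<bar> \<le> (\<integral>x. \<bar>g x\<bar> \<partial>?K n)" by (rule integral_abs_bound)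
      also have "\<dots> \<le> D"
        using g by (intro integral_le_const integrable_const_bound[where B=D]) auto
      finally show ?thesis .
    qed
    moreover have "(\<integral>x. g x \<partial>?Q) = (\<integral>n. (\<integral>x. g x \<partial>?K n) \<partial>measure_pmf (poisson_pmf z))"
      by (rule integral_bind[OF g(1) _ meas, where B'=1]) (use g(2) mass in \<open>auto intro: measure_pmf.finite_measure\<close>)
    ultimately show ?thesis using integral_poisson_pmf[OF z, of "\<lambda>n. \<integral>x. g x \<partial>?K n" D] by simp
  qed
  have sets_Q: "sets ?Q = sets borel"
    by (rule sets_bind[where N=borel]) (use K(1) in \<open>auto simp: real_distribution_def real_distribution_axioms_def\<close>)
  have "\<mu> = ?Q"
  proof (rule real_distribution_eq_laplace[OF \<mu>])
    show "real_distribution ?Q"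
      using measure_pmf.prob_space_bind[OF prob meas] sets_Q sets_eq_imp_space_eq[OF sets_Q]
      by (simp add: real_distribution_def real_distribution_axioms_def)
    show nonneg: "AE x in ?Q. 0 \<le> x"
      by (subst AE_bind[OF meas]) (use K(2) in auto)
    fix k :: nat
    \<comment> \<open>Truncated as in \<open>laplace_convolution\<close>, now to satisfy the
      boundedness premise of \<open>integral_Q\<close>.\<close>
    let ?g = "\<lambda>x. exp (- real k * max x 0)"
    have "AE x in ?Q. exp (- real k * x) = ?g x"
      using nonneg by eventually_elim (simp add: max_def)
    then have "(\<integral>x. exp (- real k * x) \<partial>?Q) = (\<integral>x. ?g x \<partial>?Q)"
      using sets_Q by (intro integral_cong_AE) (auto cong: measurable_cong_sets)
    also have "\<dots> = poisson_mean (\<lambda>n. \<integral>x. ?g x \<partial>?K n) z"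
      by (rule integral_Q[where D=1]) auto
    also have "(\<lambda>n. \<integral>x. ?g x \<partial>?K n) = (\<lambda>n. (\<integral>x. exp (- real k * x) \<partial>N) ^ n)"
    proof
      fix n
      interpret real_distribution "?K n" by (rule K)
      have "AE x in ?K n. ?g x = exp (- real k * x)"
        using K(2)[of n] by eventually_elim (simp add: max_def)
      then have "(\<integral>x. ?g x \<partial>?K n) = (\<integral>x. exp (- real k * x) \<partial>?K n)"
        by (intro integral_cong_AE) auto
      then show "(\<integral>x. ?g x \<partial>?K n) = (\<integral>x. exp (- real k * x) \<partial>N) ^ n"
        using laplace_conv_power[OF N, of "real k"] by simp
    qed
    finally show "(\<integral>x. exp (- real k * x) \<partial>\<mu>) = (\<integral>x. exp (- real k * x) \<partial>?Q)"
      using laplace[of "real k"] by (simp add: poisson_mean_power)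
  qed
  then show ?thesis using integral_Q[OF f] by simp
qed

section \<open>Levy processes and random time changes\<close>

lemma Bb_iff: "h \<in> Bb \<longleftrightarrow> h \<in> borel_measurable borel \<and> (\<exists>B. \<forall>x. \<bar>h x\<bar> \<le> B)"
  by (auto simp: Bb_def bounded_iff)

text \<open>The least multiple of 1 / (n + 1) strictly above max t 0. Being strictly above, it
  approaches the time inside the punctured right neighbourhood, where right-continuity of the paths
  applies.\<close>

definition next_grid :: "nat \<Rightarrow> real \<Rightarrow> real" where
  "next_grid n t = real (Suc (nat \<lfloor>real (Suc n) * t\<rfloor>)) / real (Suc n)"

lemma next_grid_bounds:
  "max t 0 < next_grid n t" "next_grid n t \<le> max t 0 + 1 / real (Suc n)"
proof -
  have *: "max (real (Suc n) * t) 0 < real (Suc (nat \<lfloor>real (Suc n) * t\<rfloor>))"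
    "real (Suc (nat \<lfloor>real (Suc n) * t\<rfloor>)) \<le> max (real (Suc n) * t) 0 + 1"
    by linarith+
  have m: "max (real (Suc n) * t) 0 = real (Suc n) * max t 0"
    by (simp add: max_mult_distrib_left)
  show "max t 0 < next_grid n t" "next_grid n t \<le> max t 0 + 1 / real (Suc n)"
    using * unfolding m next_grid_def
    by (simp_all only: pos_less_divide_eq pos_divide_le_eq of_nat_0_less_iff zero_less_Suc mult.commute distrib_left)
       simp_all
qed

lemma tendsto_next_grid:
  assumes "cadlag f"
  shows "(\<lambda>n. f (next_grid n t)) \<longlonglongrightarrow> f (max t 0)"
proof -
  have "(\<lambda>n. next_grid n t) \<longlonglongrightarrow> max t 0"
  proof (rule tendsto_sandwich[of "\<lambda>_. max t 0" _ _ "\<lambda>n. max t 0 + 1 / real (Suc n)"])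
    show "(\<lambda>n. max t 0 + 1 / real (Suc n)) \<longlonglongrightarrow> max t 0"
      using tendsto_add[OF tendsto_const[of "max t 0"] LIMSEQ_Suc[OF lim_1_over_n[where 'a=real]]] by simp
  qed (use next_grid_bounds in \<open>auto intro!: always_eventually less_imp_le\<close>)
  then have "filterlim (\<lambda>n. next_grid n t) (at_right (max t 0)) sequentially"
    using next_grid_bounds(1)[of t] by (auto simp: filterlim_at less_imp_neq[symmetric] intro!: always_eventually)
  moreover have "(f \<longlongrightarrow> f (max t 0)) (at_right (max t 0))"
    using assms by (simp add: cadlag_def continuous_within)
  ultimately show ?thesis by (rule filterlim_compose[rotated])
qed

section \<open>Joint measurability of the paths in time and sample point\<close>

lemma measurable_grid_index [measurable]:
  "(\<lambda>u. nat \<lfloor>real (Suc n) * u\<rfloor>) \<in> borel \<rightarrow>\<^sub>M count_space UNIV"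
  by measurable

lemma levy_measurable: "levy_process M X \<Longrightarrow> 0 \<le> t \<Longrightarrow> X t \<in> borel_measurable M"
  by (simp add: levy_process_def)

text \<open>Grid times take countably many values, so the map is glued from countably many random
  variables, one for each grid point.\<close>

lemma levy_measurable_next_grid:
  assumes "levy_process M X"
  shows "(\<lambda>p. X (next_grid n (snd p)) (fst p)) \<in> borel_measurable (M \<Otimes>\<^sub>M borel)"
  unfolding next_grid_def
proof (rule measurable_compose_countable[where f="\<lambda>k p. X (real (Suc k) / real (Suc n)) (fst p)"])
  fix k
  have "X (real (Suc k) / real (Suc n)) \<in> borel_measurable M"
    by (rule levy_measurable[OF assms]) simp
  then show "(\<lambda>p. X (real (Suc k) / real (Suc n)) (fst p)) \<in> borel_measurable (M \<Otimes>\<^sub>M borel)"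
    by (rule measurable_compose[OF measurable_fst])
qed measurable

text \<open>A pointwise limit of the grid versions, by right-continuity of every path. The
  \<open>max\<close> keeps the time in the range where X is constrained.\<close>

lemma levy_measurable_pair:
  assumes "levy_process M X"
  shows "(\<lambda>p. X (max (snd p) 0) (fst p)) \<in> borel_measurable (M \<Otimes>\<^sub>M borel)"
proof (rule borel_measurable_LIMSEQ_metric)
  show "(\<lambda>p. X (next_grid n (snd p)) (fst p)) \<in> borel_measurable (M \<Otimes>\<^sub>M borel)" for n
    by (rule levy_measurable_next_grid[OF assms])
  fix p assume "p \<in> space (M \<Otimes>\<^sub>M (borel :: real measure))"
  then have "fst p \<in> space M" by (auto simp: space_pair_measure)
  with assms have "cadlag (\<lambda>t. X t (fst p))" by (simp add: levy_process_def)
  from tendsto_next_grid[OF this] show "(\<lambda>n. X (next_grid n (snd p)) (fst p)) \<longlonglongrightarrow> X (max (snd p) 0) (fst p)" .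
qed

lemma levy_measurable_time_change:
  assumes X: "levy_process M X" and S: "S \<in> borel_measurable M" "\<And>\<omega>. \<omega> \<in> space M \<Longrightarrow> 0 \<le> S \<omega>"
  shows "(\<lambda>\<omega>. X (S \<omega>) \<omega>) \<in> borel_measurable M"
proof -
  have "(\<lambda>\<omega>. (\<omega>, S \<omega>)) \<in> M \<rightarrow>\<^sub>M M \<Otimes>\<^sub>M borel" using S(1) by simp
  from measurable_compose[OF this levy_measurable_pair[OF X]]
  have "(\<lambda>\<omega>. X (max (S \<omega>) 0) \<omega>) \<in> borel_measurable M" by simp
  then show ?thesis using S(2) by (simp add: max_absorb1 cong: measurable_cong)
qed

lemma subordinator_nonneg:
  assumes "subordinator M S" "0 \<le> t" "\<omega> \<in> space M"
  shows "0 \<le> S t \<omega>"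
proof -
  have "S 0 \<omega> \<le> S t \<omega>" "0 \<le> S 0 \<omega>"
    using assms by (auto simp: subordinator_def intro: mono_onD[of "{0..}" "\<lambda>t. S t \<omega>"])
  then show ?thesis by simp
qed

text \<open>At grid times, evaluating one path at a time read off the other selects one of countably
  many coordinates, so \<open>?\<Phi>\<close> is measurable on the product of the path spaces.
  Independence makes the joint law of the paths a product, represented by two copies \<omega>,
  \<omega>' of the sample space; only S t is then retained from the second copy.\<close>

lemma distr_time_change_grid:
  assumes X: "levy_process M X" and indep: "independent_processes M X S"
    and t: "0 \<le> t"
  shows "distr M borel (\<lambda>\<omega>. X (next_grid n (S t \<omega>)) \<omega>)
     = distr (M \<Otimes>\<^sub>M distr M borel (S t)) borel (\<lambda>p. X (next_grid n (snd p)) (fst p))"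
proof -
  interpret prob_space M using X by (simp add: levy_process_def)
  let ?P = "\<Pi>\<^sub>M i\<in>{0::real..}. (borel :: real measure)"
  let ?X = "\<lambda>\<omega>. \<lambda>u\<in>{0..}. X u \<omega>" and ?S = "\<lambda>\<omega>. \<lambda>u\<in>{0..}. S u \<omega>"
  let ?\<Phi> = "\<lambda>p::(real \<Rightarrow> real) \<times> (real \<Rightarrow> real). fst p (next_grid n (snd p t))"
  have ind: "indep_var ?P ?X ?P ?S"
    using indep unfolding independent_processes_def .
  then have path: "?X \<in> M \<rightarrow>\<^sub>M ?P" "?S \<in> M \<rightarrow>\<^sub>M ?P"
    by (auto dest: indep_var_rv1 indep_var_rv2)
  have St: "S t \<in> borel_measurable M"
    using measurable_compose[OF path(2) measurable_component_singleton[of t]] t by simp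
  have \<Phi>: "?\<Phi> \<in> borel_measurable (?P \<Otimes>\<^sub>M ?P)"
    unfolding next_grid_def
  proof (rule measurable_compose_countable[where f="\<lambda>k p. fst p (real (Suc k) / real (Suc n))"])
    fix k
    have "(\<lambda>p. p (real (Suc k) / real (Suc n))) \<in> borel_measurable ?P"
      by (rule measurable_component_singleton) simp
    then show "(\<lambda>p. fst p (real (Suc k) / real (Suc n))) \<in> borel_measurable (?P \<Otimes>\<^sub>M ?P)"
      by (rule measurable_compose[OF measurable_fst])
    have "(\<lambda>p. p t) \<in> borel_measurable ?P"
      by (rule measurable_component_singleton) (simp add: t)
    then have "(\<lambda>p. snd p t) \<in> borel_measurable (?P \<Otimes>\<^sub>M ?P)"
      by (rule measurable_compose[OF measurable_snd])
    from measurable_compose[OF this measurable_grid_index]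
    show "(\<lambda>p. nat \<lfloor>real (Suc n) * snd p t\<rfloor>) \<in> ?P \<Otimes>\<^sub>M ?P \<rightarrow>\<^sub>M count_space UNIV" .
  qed
  have grid: "next_grid n u \<in> {0..}" for u
    using next_grid_bounds(1)[of u n] by simp
  have "distr M borel (\<lambda>\<omega>. X (next_grid n (S t \<omega>)) \<omega>)
      = distr (distr M (?P \<Otimes>\<^sub>M ?P) (\<lambda>\<omega>. (?X \<omega>, ?S \<omega>))) borel ?\<Phi>"
    using path \<Phi> grid t by (subst distr_distr) (auto simp: comp_def)
  also have "distr M (?P \<Otimes>\<^sub>M ?P) (\<lambda>\<omega>. (?X \<omega>, ?S \<omega>)) = distr M ?P ?X \<Otimes>\<^sub>M distr M ?P ?S"
    using ind by (simp add: indep_var_distribution_eq)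
  also have "\<dots> = distr (M \<Otimes>\<^sub>M M) (?P \<Otimes>\<^sub>M ?P) (\<lambda>(\<omega>, \<omega>'). (?X \<omega>, ?S \<omega>'))"
    by (rule pair_measure_distr[OF path]) (intro prob_space_imp_sigma_finite prob_space_distr path)
  also have "distr \<dots> borel ?\<Phi> = distr (M \<Otimes>\<^sub>M M) borel (\<lambda>p. X (next_grid n (S t (snd p))) (fst p))"
  proof (subst distr_distr[OF \<Phi>])
    show "(\<lambda>(\<omega>, \<omega>'). (?X \<omega>, ?S \<omega>')) \<in> M \<Otimes>\<^sub>M M \<rightarrow>\<^sub>M ?P \<Otimes>\<^sub>M ?P"
      unfolding case_prod_unfold
      by (intro measurable_Pair measurable_compose[OF measurable_fst path(1)] measurable_compose[OF measurable_snd path(2)])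
  qed (use grid t in \<open>auto simp: comp_def case_prod_unfold\<close>)
  also have "\<dots> = distr (distr (M \<Otimes>\<^sub>M M) (M \<Otimes>\<^sub>M borel) (\<lambda>(\<omega>, \<omega>'). (\<omega>, S t \<omega>'))) borel (\<lambda>p. X (next_grid n (snd p)) (fst p))"
    using St by (subst distr_distr[OF levy_measurable_next_grid[OF X]]) (auto simp: comp_def case_prod_unfold)
  also have "distr (M \<Otimes>\<^sub>M M) (M \<Otimes>\<^sub>M borel) (\<lambda>(\<omega>, \<omega>'). (\<omega>, S t \<omega>')) = distr M M (\<lambda>\<omega>. \<omega>) \<Otimes>\<^sub>M distr M borel (S t)"
    by (rule pair_measure_distr[symmetric]) (use St in \<open>auto intro: prob_space_imp_sigma_finite prob_space_distr\<close>)
  finally show ?thesis by (simp add: distr_id2)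
qed

text \<open>Evaluation of a path at a time is not measurable on the product \<open>\<sigma>\<close>-algebra;
  independence is therefore used at the grid times only, and the limit is taken in the
  characteristic functions.\<close>

lemma distr_time_change:
  assumes X: "levy_process M X" and S: "subordinator M S" and indep: "independent_processes M X S"
    and t: "0 \<le> t"
  shows "distr M borel (\<lambda>\<omega>. X (S t \<omega>) \<omega>)
     = distr (M \<Otimes>\<^sub>M distr M borel (S t)) borel (\<lambda>p. X (max (snd p) 0) (fst p))"
proof -
  interpret prob_space M using X by (simp add: levy_process_def)
  let ?\<mu> = "distr M borel (S t)"
  have St: "S t \<in> borel_measurable M" using S t by (simp add: subordinator_def levy_measurable)
  interpret \<mu>: prob_space ?\<mu> using St by (rule prob_space_distr)
  interpret P: pair_prob_space M ?\<mu> ..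
  have sets: "sets (M \<Otimes>\<^sub>M ?\<mu>) = sets (M \<Otimes>\<^sub>M borel)" by (intro sets_pair_measure_cong) auto
  have cad: "cadlag (\<lambda>u. X u \<omega>)" if "\<omega> \<in> space M" for \<omega>
    using X that by (simp add: levy_process_def)
  have XS: "(\<lambda>\<omega>. X (S t \<omega>) \<omega>) \<in> borel_measurable M"
    using subordinator_nonneg[OF S t] by (rule levy_measurable_time_change[OF X St])
  have grid: "(\<lambda>p. X (next_grid n (snd p)) (fst p)) \<in> borel_measurable (M \<Otimes>\<^sub>M ?\<mu>)" for n
    using levy_measurable_next_grid[OF X] by (simp add: measurable_cong_sets[OF sets refl])
  have pair: "(\<lambda>p. X (max (snd p) 0) (fst p)) \<in> borel_measurable (M \<Otimes>\<^sub>M ?\<mu>)"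
    using levy_measurable_pair[OF X] by (simp add: measurable_cong_sets[OF sets refl])
  have gridS: "(\<lambda>\<omega>. X (next_grid n (S t \<omega>)) \<omega>) \<in> borel_measurable M" for n
  proof -
    have "(\<lambda>\<omega>. (\<omega>, S t \<omega>)) \<in> M \<rightarrow>\<^sub>M M \<Otimes>\<^sub>M borel" using St by simp
    from measurable_compose[OF this levy_measurable_next_grid[OF X]] show ?thesis by simp
  qed
  have iexp: "(\<lambda>x. iexp (\<theta> * x)) \<in> borel_measurable borel" for \<theta> by measurable
  show ?thesis
  proof (rule Levy_uniqueness)
    show "char (distr M borel (\<lambda>\<omega>. X (S t \<omega>) \<omega>))
      = char (distr (M \<Otimes>\<^sub>M ?\<mu>) borel (\<lambda>p. X (max (snd p) 0) (fst p)))"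
    proof
      fix \<theta> :: real
      have "(\<lambda>n. \<integral>\<omega>. iexp (\<theta> * X (next_grid n (S t \<omega>)) \<omega>) \<partial>M) \<longlonglongrightarrow> (\<integral>\<omega>. iexp (\<theta> * X (S t \<omega>) \<omega>) \<partial>M)"
      proof (rule integral_dominated_convergence[where w="\<lambda>_. 1"])
        show "AE \<omega> in M. (\<lambda>n. iexp (\<theta> * X (next_grid n (S t \<omega>)) \<omega>)) \<longlonglongrightarrow> iexp (\<theta> * X (S t \<omega>) \<omega>)"
        proof (rule AE_I2)
          fix \<omega> assume "\<omega> \<in> space M"
          with tendsto_next_grid[OF cad, of \<omega> "S t \<omega>"] subordinator_nonneg[OF S t, of \<omega>]
          show "(\<lambda>n. iexp (\<theta> * X (next_grid n (S t \<omega>)) \<omega>)) \<longlonglongrightarrow> iexp (\<theta> * X (S t \<omega>) \<omega>)"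
            by (intro tendsto_intros) (simp add: max_absorb1)
        qed
      qed (use measurable_compose[OF XS iexp] measurable_compose[OF gridS iexp] in auto)
      moreover have "(\<lambda>n. \<integral>p. iexp (\<theta> * X (next_grid n (snd p)) (fst p)) \<partial>(M \<Otimes>\<^sub>M ?\<mu>))
          \<longlonglongrightarrow> (\<integral>p. iexp (\<theta> * X (max (snd p) 0) (fst p)) \<partial>(M \<Otimes>\<^sub>M ?\<mu>))"
      proof (rule integral_dominated_convergence[where w="\<lambda>_. 1"])
        show "AE p in M \<Otimes>\<^sub>M ?\<mu>. (\<lambda>n. iexp (\<theta> * X (next_grid n (snd p)) (fst p))) \<longlonglongrightarrow> iexp (\<theta> * X (max (snd p) 0) (fst p))"
        proof (rule AE_I2)
          fix p assume "p \<in> space (M \<Otimes>\<^sub>M ?\<mu>)"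
          then have "fst p \<in> space M" by (auto simp: space_pair_measure)
          from tendsto_next_grid[OF cad[OF this], of "snd p"]
          show "(\<lambda>n. iexp (\<theta> * X (next_grid n (snd p)) (fst p))) \<longlonglongrightarrow> iexp (\<theta> * X (max (snd p) 0) (fst p))"
            by (intro tendsto_intros)
        qed
      qed (use measurable_compose[OF pair iexp] measurable_compose[OF grid iexp] in auto)
      moreover have "(\<integral>\<omega>. iexp (\<theta> * X (next_grid n (S t \<omega>)) \<omega>) \<partial>M)
          = (\<integral>p. iexp (\<theta> * X (next_grid n (snd p)) (fst p)) \<partial>(M \<Otimes>\<^sub>M ?\<mu>))" for n
      proof -
        have "(\<integral>\<omega>. iexp (\<theta> * X (next_grid n (S t \<omega>)) \<omega>) \<partial>M)
            = (\<integral>x. iexp (\<theta> * x) \<partial>distr M borel (\<lambda>\<omega>. X (next_grid n (S t \<omega>)) \<omega>))"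
          by (rule integral_distr[OF gridS iexp, symmetric])
        also have "\<dots> = (\<integral>p. iexp (\<theta> * X (next_grid n (snd p)) (fst p)) \<partial>(M \<Otimes>\<^sub>M ?\<mu>))"
          unfolding distr_time_change_grid[OF X indep t] by (rule integral_distr[OF grid iexp])
        finally show ?thesis .
      qed
      ultimately have "(\<integral>\<omega>. iexp (\<theta> * X (S t \<omega>) \<omega>) \<partial>M) = (\<integral>p. iexp (\<theta> * X (max (snd p) 0) (fst p)) \<partial>(M \<Otimes>\<^sub>M ?\<mu>))"
        by (auto intro: LIMSEQ_unique)
      then show "char (distr M borel (\<lambda>\<omega>. X (S t \<omega>) \<omega>)) \<theta>
        = char (distr (M \<Otimes>\<^sub>M ?\<mu>) borel (\<lambda>p. X (max (snd p) 0) (fst p))) \<theta>"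
        unfolding char_def integral_distr[OF XS iexp] integral_distr[OF pair iexp] .
    qed
  qed (auto intro!: real_distribution_distr P.real_distribution_distr XS pair)
qed

section \<open>The transition semigroup on bounded Borel functions\<close>

lemma levy_semigroup_distr:
  assumes "levy_process M X" "0 \<le> s" "h \<in> Bb"
  shows "levy_semigroup M X s h x = (\<integral>y. h (x + y) \<partial>distr M borel (X s))"
  using assms by (auto simp: levy_semigroup_def Bb_iff integral_distr levy_measurable)

lemma levy_semigroup_bound:
  assumes X: "levy_process M X" and s: "0 \<le> s" and h: "h \<in> borel_measurable borel" "\<And>x. \<bar>h x\<bar> \<le> B"
  shows "\<bar>levy_semigroup M X s h x\<bar> \<le> B"
proof -
  interpret prob_space M using X by (simp add: levy_process_def)
  have [measurable]: "X s \<in> borel_measurable M" "h \<in> borel_measurable borel" using X s h by (auto simp: levy_measurable)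
  have "\<bar>levy_semigroup M X s h x\<bar> \<le> (\<integral>\<omega>. \<bar>h (x + X s \<omega>)\<bar> \<partial>M)"
    unfolding levy_semigroup_def by (rule integral_abs_bound)
  also have "\<dots> \<le> B"
    using h(2) by (intro integral_le_const integrable_const_bound[where B=B]) auto
  finally show ?thesis .
qed

text \<open>A parameter integral of a jointly measurable integrand. Measurability in the pair of
  time and space is what the later exchanges of integrals need.\<close>

lemma levy_semigroup_measurable:
  assumes X: "levy_process M X" and [measurable]: "h \<in> borel_measurable borel"
  shows "(\<lambda>p. levy_semigroup M X (max (fst p) 0) h (snd p)) \<in> borel_measurable (borel \<Otimes>\<^sub>M borel)"
proof -
  interpret prob_space M using X by (simp add: levy_process_def)
  have [measurable]: "(\<lambda>q. X (max (fst (fst q)) 0) (snd q)) \<in> borel_measurable ((borel \<Otimes>\<^sub>M borel) \<Otimes>\<^sub>M M)"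
    using measurable_compose[OF _ levy_measurable_pair[OF X], where f="\<lambda>q. (snd q, fst (fst q))" and M="(borel \<Otimes>\<^sub>M borel) \<Otimes>\<^sub>M M"] by simp
  show ?thesis
    unfolding levy_semigroup_def by (rule borel_measurable_lebesgue_integral) (simp add: case_prod_unfold)
qed

lemma levy_semigroup_measurable_compose:
  assumes "levy_process M X" "h \<in> borel_measurable borel"
    and "f \<in> borel_measurable N" "g \<in> borel_measurable N"
  shows "(\<lambda>q. levy_semigroup M X (max (f q) 0) h (g q)) \<in> borel_measurable N"
  using measurable_compose[OF _ levy_semigroup_measurable[OF assms(1,2)], where f="\<lambda>q. (f q, g q)" and M=N] assms(3,4) by simp

lemma levy_distr_add:
  assumes X: "levy_process M X" and s: "0 \<le> s" and u: "0 \<le> u"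
  shows "distr M borel (X (s + u)) = convolution (distr M borel (X s)) (distr M borel (X u))"
proof -
  interpret prob_space M using X by (simp add: levy_process_def)
  have meas [measurable]: "X 0 \<in> borel_measurable M" "X s \<in> borel_measurable M" "X (s + u) \<in> borel_measurable M"
    using X s u by (auto simp: levy_measurable)
  \<comment> \<open>Only the indices 0, 1, 2 are used: they give the increments over [0, s] and
    [s, s + u].\<close>
  define \<tau> where "\<tau> i = (if i = 0 then 0 else if i = 1 then s else s + u)" for i :: nat
  have ind: "indep_vars (\<lambda>_. borel) (\<lambda>i \<omega>. X (\<tau> (Suc i)) \<omega> - X (\<tau> i) \<omega>) {..<2}"
  proof -
    have "0 \<le> \<tau> 0 \<and> (\<forall>i<2. \<tau> i \<le> \<tau> (Suc i))" using s u by (auto simp: \<tau>_def)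
    then show ?thesis using X unfolding levy_process_def by blast
  qed
  \<comment> \<open>Restricting the independent family to two disjoint singletons gives independent
    product-valued variables; the coordinate projections then return the two real
    increments.\<close>
  have "indep_var (PiM {0} (\<lambda>_. borel)) (\<lambda>\<omega>. \<lambda>i\<in>{0}. X (\<tau> (Suc i)) \<omega> - X (\<tau> i) \<omega>)
      (PiM {1} (\<lambda>_. borel)) (\<lambda>\<omega>. \<lambda>i\<in>{1}. X (\<tau> (Suc i)) \<omega> - X (\<tau> i) \<omega>)"
    by (rule indep_var_restrict[OF ind]) auto
  from indep_var_compose[OF this measurable_component_singleton[of 0] measurable_component_singleton[of 1]]
  have iv: "indep_var borel (\<lambda>\<omega>. X s \<omega> - X 0 \<omega>) borel (\<lambda>\<omega>. X (s + u) \<omega> - X s \<omega>)"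
    by (simp add: comp_def \<tau>_def)
  have X0: "AE \<omega> in M. X 0 \<omega> = 0" using X by (simp add: levy_process_def)
  have "distr M borel (X (s + u)) = distr M borel (\<lambda>\<omega>. (X s \<omega> - X 0 \<omega>) + (X (s + u) \<omega> - X s \<omega>))"
    using X0 by (intro distr_cong_AE) auto
  also have "\<dots> = convolution (distr M borel (\<lambda>\<omega>. X s \<omega> - X 0 \<omega>)) (distr M borel (\<lambda>\<omega>. X (s + u) \<omega> - X s \<omega>))"
    by (rule sum_indep_random_variable[OF iv]) measurable
  also have "distr M borel (\<lambda>\<omega>. X s \<omega> - X 0 \<omega>) = distr M borel (X s)"
    using X0 by (intro distr_cong_AE) auto
  also have "distr M borel (\<lambda>\<omega>. X (s + u) \<omega> - X s \<omega>) = distr M borel (X u)"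
    using X s u by (simp add: levy_process_def)
  finally show ?thesis .
qed

lemma levy_semigroup_Bb:
  assumes X: "levy_process M X" and s: "0 \<le> s" and h: "h \<in> Bb"
  shows "levy_semigroup M X s h \<in> Bb"
proof -
  from h obtain B where [measurable]: "h \<in> borel_measurable borel" and B: "\<And>x. \<bar>h x\<bar> \<le> B"
    by (auto simp: Bb_iff)
  have "(\<lambda>x. levy_semigroup M X (max s 0) h x) \<in> borel_measurable borel"
    by (rule levy_semigroup_measurable_compose[OF X]) measurable
  with s levy_semigroup_bound[OF X s, of h B] B show ?thesis
    by (auto simp: Bb_iff max_absorb1)
qed

lemma levy_semigroup_add:
  assumes X: "levy_process M X" and s: "0 \<le> s" and u: "0 \<le> u" and h: "h \<in> Bb"
  shows "levy_semigroup M X s (levy_semigroup M X u h) x = levy_semigroup M X (s + u) h x"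
proof -
  interpret prob_space M using X by (simp add: levy_process_def)
  from h obtain B where [measurable]: "h \<in> borel_measurable borel" and B: "\<And>x. \<bar>h x\<bar> \<le> B"
    by (auto simp: Bb_iff)
  have rd: "real_distribution (distr M borel (X s))" "real_distribution (distr M borel (X u))"
    using X s u by (auto intro: real_distribution_distr simp: levy_measurable)
  have "levy_semigroup M X s (levy_semigroup M X u h) x = (\<integral>a. levy_semigroup M X u h (x + a) \<partial>distr M borel (X s))"
    by (intro levy_semigroup_distr[OF X s] levy_semigroup_Bb[OF X u h])
  also have "\<dots> = (\<integral>a. (\<integral>b. h (x + (a + b)) \<partial>distr M borel (X u)) \<partial>distr M borel (X s))"
    by (simp add: levy_semigroup_distr[OF X u h] add.assoc)
  also have "\<dots> = (\<integral>y. h (x + y) \<partial>distr M borel (X (s + u)))"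
    unfolding levy_distr_add[OF X s u] by (rule integral_convolution[OF rd, symmetric, where B=B]) (auto simp: B)
  also have "\<dots> = levy_semigroup M X (s + u) h x"
    using s u by (intro levy_semigroup_distr[OF X _ h, symmetric]) simp
  finally show ?thesis .
qed

section \<open>Subordination as an average over the law of the random time\<close>

lemma subordinate_semigroup_eq:
  assumes X: "levy_process M X" and S: "subordinator M S" and indep: "independent_processes M X S"
    and t: "0 \<le> t" and h: "h \<in> Bb"
  shows "subordinate_semigroup M X S t h x = (\<integral>u. levy_semigroup M X (max u 0) h x \<partial>distr M borel (S t))"
proof -
  interpret prob_space M using X by (simp add: levy_process_def)
  from h obtain B where [measurable]: "h \<in> borel_measurable borel" and B: "\<And>x. \<bar>h x\<bar> \<le> B"
    by (auto simp: Bb_iff)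
  have St: "S t \<in> borel_measurable M" using S t by (simp add: subordinator_def levy_measurable)
  let ?\<mu> = "distr M borel (S t)"
  interpret \<mu>: prob_space ?\<mu> using St by (rule prob_space_distr)
  interpret P: pair_prob_space M ?\<mu> ..
  have sets: "sets (M \<Otimes>\<^sub>M ?\<mu>) = sets (M \<Otimes>\<^sub>M borel)" by (intro sets_pair_measure_cong) auto
  have XS: "(\<lambda>\<omega>. X (S t \<omega>) \<omega>) \<in> borel_measurable M"
    using subordinator_nonneg[OF S t] by (rule levy_measurable_time_change[OF X St])
  have pair [measurable]: "(\<lambda>p. X (max (snd p) 0) (fst p)) \<in> borel_measurable (M \<Otimes>\<^sub>M ?\<mu>)"
    using levy_measurable_pair[OF X] by (simp add: measurable_cong_sets[OF sets refl])
  have "subordinate_semigroup M X S t h x = (\<integral>y. h (x + y) \<partial>distr M borel (\<lambda>\<omega>. X (S t \<omega>) \<omega>))"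
    unfolding subordinate_semigroup_def by (rule integral_distr[OF XS, symmetric]) measurable
  also have "\<dots> = (\<integral>p. h (x + X (max (snd p) 0) (fst p)) \<partial>(M \<Otimes>\<^sub>M ?\<mu>))"
    unfolding distr_time_change[OF X S indep t] by (rule integral_distr[OF pair]) measurable
  also have "\<dots> = (\<integral>u. (\<integral>\<omega>. h (x + X (max u 0) \<omega>) \<partial>M) \<partial>?\<mu>)"
  proof -
    have "integrable (M \<Otimes>\<^sub>M ?\<mu>) (\<lambda>p. h (x + X (max (snd p) 0) (fst p)))"
      by (rule P.integrable_const_bound[where B=B]) (auto simp: B)
    then have "integrable (M \<Otimes>\<^sub>M ?\<mu>) (\<lambda>(\<omega>, u). h (x + X (max u 0) \<omega>))"
      by (simp only: case_prod_unfold)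
    from P.integral_snd[OF this] show ?thesis by (simp only: case_prod_unfold)
  qed
  finally show ?thesis by (simp add: levy_semigroup_def)
qed

lemma subordinate_semigroup_Bb:
  assumes X: "levy_process M X" and S: "subordinator M S" and indep: "independent_processes M X S"
    and t: "0 \<le> t" and h: "h \<in> Bb"
  shows "subordinate_semigroup M X S t h \<in> Bb"
proof -
  interpret prob_space M using X by (simp add: levy_process_def)
  from h obtain B where [measurable]: "h \<in> borel_measurable borel" and B: "\<And>x. \<bar>h x\<bar> \<le> B"
    by (auto simp: Bb_iff)
  have St: "S t \<in> borel_measurable M" using S t by (simp add: subordinator_def levy_measurable)
  interpret \<mu>: prob_space "distr M borel (S t)" using St by (rule prob_space_distr)
  have "(\<lambda>p. levy_semigroup M X (max (snd p) 0) h (fst p)) \<in> borel_measurable (borel \<Otimes>\<^sub>M distr M borel (S t))"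
    by (rule levy_semigroup_measurable_compose[OF X]) measurable
  then have "(\<lambda>x. \<integral>u. levy_semigroup M X (max u 0) h x \<partial>distr M borel (S t)) \<in> borel_measurable borel"
    by (intro \<mu>.borel_measurable_lebesgue_integral) (simp add: case_prod_unfold)
  moreover have "\<bar>\<integral>u. levy_semigroup M X (max u 0) h x \<partial>distr M borel (S t)\<bar> \<le> B" for x
  proof -
    have m: "(\<lambda>u. levy_semigroup M X (max u 0) h x) \<in> borel_measurable borel"
      by (rule levy_semigroup_measurable_compose[OF X]) measurable
    have b: "\<bar>levy_semigroup M X (max u 0) h x\<bar> \<le> B" for u
      by (rule levy_semigroup_bound[OF X]) (auto simp: B)
    have "\<bar>\<integral>u. levy_semigroup M X (max u 0) h x \<partial>distr M borel (S t)\<bar>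
        \<le> (\<integral>u. \<bar>levy_semigroup M X (max u 0) h x\<bar> \<partial>distr M borel (S t))"
      by (rule integral_abs_bound)
    also have "\<dots> \<le> B"
      using m b by (intro \<mu>.integral_le_const \<mu>.integrable_const_bound[where B=B]) auto
    finally show ?thesis .
  qed
  ultimately show ?thesis
    unfolding Bb_iff subordinate_semigroup_eq[OF X S indep t h, abs_def] by blast
qed

text \<open>T s is moved under the average over S t by Fubini and merged with T u by the semigroup
  law. An action in the space variable thus becomes a shift of the time variable, comparable with
  adding a jump to S t.\<close>

lemma levy_subordinate_semigroup:
  assumes X: "levy_process M X" and S: "subordinator M S" and indep: "independent_processes M X S"
    and t: "0 \<le> t" and h: "h \<in> Bb" and s: "0 \<le> s"
  shows "levy_semigroup M X s (subordinate_semigroup M X S t h) x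
    = (\<integral>u. levy_semigroup M X (s + max u 0) h x \<partial>distr M borel (S t))"
proof -
  interpret prob_space M using X by (simp add: levy_process_def)
  from h obtain B where [measurable]: "h \<in> borel_measurable borel" and B: "\<And>x. \<bar>h x\<bar> \<le> B"
    by (auto simp: Bb_iff)
  have St: "S t \<in> borel_measurable M" using S t by (simp add: subordinator_def levy_measurable)
  let ?\<mu> = "distr M borel (S t)"
  interpret \<mu>: prob_space ?\<mu> using St by (rule prob_space_distr)
  interpret P: pair_prob_space M ?\<mu> ..
  have [measurable]: "X s \<in> borel_measurable M" using X s by (rule levy_measurable)
  have m: "(\<lambda>p. levy_semigroup M X (max (snd p) 0) h (x + X s (fst p))) \<in> borel_measurable (M \<Otimes>\<^sub>M ?\<mu>)"
    by (rule levy_semigroup_measurable_compose[OF X]) measurable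
  have b: "\<bar>levy_semigroup M X (max u 0) h y\<bar> \<le> B" for u y
    by (rule levy_semigroup_bound[OF X]) (auto simp: B)
  have "levy_semigroup M X s (subordinate_semigroup M X S t h) x
     = (\<integral>\<omega>. (\<integral>u. levy_semigroup M X (max u 0) h (x + X s \<omega>) \<partial>?\<mu>) \<partial>M)"
    by (simp add: levy_semigroup_def[of M X s] subordinate_semigroup_eq[OF X S indep t h])
  also have "\<dots> = (\<integral>u. (\<integral>\<omega>. levy_semigroup M X (max u 0) h (x + X s \<omega>) \<partial>M) \<partial>?\<mu>)"
    using m b by (intro P.Fubini_integral[symmetric] P.integrable_const_bound[where B=B]) (auto simp: case_prod_unfold)
  also have "\<dots> = (\<integral>u. levy_semigroup M X (s + max u 0) h x \<partial>?\<mu>)"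
    using levy_semigroup_add[OF X s _ h] by (simp add: levy_semigroup_def[of M X s])
  finally show ?thesis .
qed

section \<open>The evolution equation\<close>

text \<open>The total mass of the shifted density over [\<epsilon>, \<infinity>), see
  \<open>shifted_density_mass\<close>; it is the jump intensity of the compound Poisson
  process.\<close>

definition jump_rate :: "real \<Rightarrow> real \<Rightarrow> real" where
  "jump_rate \<alpha> \<epsilon> = \<alpha> / \<epsilon> powr \<alpha> * Gamma \<alpha>"

definition jump_law :: "real \<Rightarrow> real \<Rightarrow> real measure" where
  "jump_law \<alpha> \<epsilon> = density lborel (\<lambda>s. ennreal (indicator {\<epsilon>..} s * shifted_density \<alpha> \<epsilon> s / jump_rate \<alpha> \<epsilon>))"

context
  fixes \<alpha> \<epsilon> :: real
  assumes \<alpha>: "0 < \<alpha>" "\<alpha> < 1" and \<epsilon>: "0 < \<epsilon>"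
begin

lemma jump_rate_pos: "0 < jump_rate \<alpha> \<epsilon>"
  using \<alpha> \<epsilon> by (simp add: jump_rate_def Gamma_real_pos)

lemma jump_density_nonneg: "0 \<le> indicator {\<epsilon>..} s * shifted_density \<alpha> \<epsilon> s / jump_rate \<alpha> \<epsilon>"
  using shifted_density_nonneg[OF \<alpha>, of \<epsilon> s] jump_rate_pos by (simp add: divide_nonneg_pos)

lemma real_distribution_jump_law: "real_distribution (jump_law \<alpha> \<epsilon>)"
proof -
  have hb: "has_bochner_integral lborel (\<lambda>s. indicator {\<epsilon>..} s * shifted_density \<alpha> \<epsilon> s / jump_rate \<alpha> \<epsilon>)
      (jump_rate \<alpha> \<epsilon> / jump_rate \<alpha> \<epsilon>)"
    using shifted_density_mass[OF \<alpha> \<epsilon>] unfolding jump_rate_def by (rule has_bochner_integral_divide_zero)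
  have "(\<integral>\<^sup>+s. ennreal (indicator {\<epsilon>..} s * shifted_density \<alpha> \<epsilon> s / jump_rate \<alpha> \<epsilon>) \<partial>lborel) = 1"
    using nn_integral_eq_integral[OF integrable.intros[OF hb] AE_I2[OF jump_density_nonneg]]
      has_bochner_integral_integral_eq[OF hb] jump_rate_pos by simp
  then have "emeasure (jump_law \<alpha> \<epsilon>) (space (jump_law \<alpha> \<epsilon>)) = 1"
    by (simp add: jump_law_def emeasure_density)
  then show ?thesis
    by (auto simp: real_distribution_def real_distribution_axioms_def jump_law_def intro: prob_spaceI)
qed

lemma AE_jump_law: "AE s in jump_law \<alpha> \<epsilon>. \<epsilon> \<le> s"
  unfolding jump_law_def by (subst AE_density) (auto split: split_indicator)

lemma integral_jump_law:
  fixes \<phi> :: "real \<Rightarrow> real"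
  assumes [measurable]: "\<phi> \<in> borel_measurable borel" and b: "\<And>s. \<bar>\<phi> s\<bar> \<le> B"
  shows "integrable lborel (\<lambda>s. indicator {\<epsilon>..} s * (\<phi> s * shifted_density \<alpha> \<epsilon> s))"
    and "(\<integral>s. indicator {\<epsilon>..} s * (\<phi> s * shifted_density \<alpha> \<epsilon> s) \<partial>lborel) = jump_rate \<alpha> \<epsilon> * (\<integral>s. \<phi> s \<partial>jump_law \<alpha> \<epsilon>)"
proof -
  have "integrable lborel (\<lambda>s. B * (indicator {\<epsilon>..} s * shifted_density \<alpha> \<epsilon> s))"
    using shifted_density_mass[OF \<alpha> \<epsilon>] by (intro integrable_mult_right) (auto simp: has_bochner_integral_iff)
  then show "integrable lborel (\<lambda>s. indicator {\<epsilon>..} s * (\<phi> s * shifted_density \<alpha> \<epsilon> s))"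
  proof (rule Bochner_Integration.integrable_bound)
    show "AE s in lborel. norm (indicator {\<epsilon>..} s * (\<phi> s * shifted_density \<alpha> \<epsilon> s))
        \<le> norm (B * (indicator {\<epsilon>..} s * shifted_density \<alpha> \<epsilon> s))"
      using mult_right_mono[OF order_trans[OF b abs_ge_self] shifted_density_nonneg[OF \<alpha>]]
        shifted_density_nonneg[OF \<alpha>]
      by (intro AE_I2) (auto simp: abs_mult split: split_indicator)
  qed simp
  have "(\<integral>s. \<phi> s \<partial>jump_law \<alpha> \<epsilon>) = (\<integral>s. (indicator {\<epsilon>..} s * shifted_density \<alpha> \<epsilon> s / jump_rate \<alpha> \<epsilon>) *\<^sub>R \<phi> s \<partial>lborel)"
    unfolding jump_law_def by (rule integral_density) (use jump_density_nonneg in auto)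
  also have "\<dots> = (\<integral>s. indicator {\<epsilon>..} s * (\<phi> s * shifted_density \<alpha> \<epsilon> s) / jump_rate \<alpha> \<epsilon> \<partial>lborel)"
    by (intro Bochner_Integration.integral_cong) auto
  finally show "(\<integral>s. indicator {\<epsilon>..} s * (\<phi> s * shifted_density \<alpha> \<epsilon> s) \<partial>lborel) = jump_rate \<alpha> \<epsilon> * (\<integral>s. \<phi> s \<partial>jump_law \<alpha> \<epsilon>)"
    using jump_rate_pos by simp
qed

text \<open>The rate cancels the \<Gamma>(\<alpha>) in the transform of the density and leaves the
  lower incomplete gamma function. This identifies the prescribed exponent as that of a compound
  Poisson process.\<close>

lemma laplace_jump_law:
  assumes \<eta>: "0 \<le> \<eta>"
  shows "jump_rate \<alpha> \<epsilon> * ((\<integral>s. exp (- \<eta> * s) \<partial>jump_law \<alpha> \<epsilon>) - 1) = - (\<alpha> / \<epsilon> powr \<alpha> * lower_incomplete_gamma \<alpha> (\<eta> * \<epsilon>))"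
proof -
  have "(\<integral>s. exp (- \<eta> * s) \<partial>jump_law \<alpha> \<epsilon>) = (\<integral>s. (indicator {\<epsilon>..} s * shifted_density \<alpha> \<epsilon> s / jump_rate \<alpha> \<epsilon>) *\<^sub>R exp (- \<eta> * s) \<partial>lborel)"
    unfolding jump_law_def by (rule integral_density) (use jump_density_nonneg in auto)
  also have "\<dots> = (\<integral>s. indicator {\<epsilon>..} s * shifted_density \<alpha> \<epsilon> s * exp (- (\<eta> * s)) / jump_rate \<alpha> \<epsilon> \<partial>lborel)"
    by (intro Bochner_Integration.integral_cong) auto
  also have "\<dots> = (\<alpha> / \<epsilon> powr \<alpha> * (Gamma \<alpha> - lower_incomplete_gamma \<alpha> (\<eta> * \<epsilon>))) / jump_rate \<alpha> \<epsilon>"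
    using shifted_density_integral_exp[OF \<alpha> \<epsilon> \<eta>] by (simp add: has_bochner_integral_iff)
  finally have I: "(\<integral>s. exp (- \<eta> * s) \<partial>jump_law \<alpha> \<epsilon>) = \<dots>" .
  have *: "r * (A / r - 1) = A - r" if "r \<noteq> 0" for r A :: real
    using that by (simp add: right_diff_distrib)
  have "jump_rate \<alpha> \<epsilon> \<noteq> 0" using jump_rate_pos by simp
  from *[OF this] show ?thesis
    unfolding I by (simp only:) (simp add: jump_rate_def right_diff_distrib)
qed

text \<open>Normalising the density to a probability law displays the operator as rate times
  (average of T over one jump minus identity), a bounded operator.\<close>

lemma approx_neg_frac_power_jump_law:
  assumes X: "levy_process M X" and g: "g \<in> Bb"
  shows "set_integrable lborel {\<epsilon>..} (\<lambda>s. (levy_semigroup M X s g x - g x) * shifted_density \<alpha> \<epsilon> s)"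
    and "approx_neg_frac_power (levy_semigroup M X) \<alpha> \<epsilon> g x
      = jump_rate \<alpha> \<epsilon> * (\<integral>s. (levy_semigroup M X (max s 0) g x - g x) \<partial>jump_law \<alpha> \<epsilon>)"
proof -
  from g obtain B where [measurable]: "g \<in> borel_measurable borel" and B: "\<And>x. \<bar>g x\<bar> \<le> B"
    by (auto simp: Bb_iff)
  let ?\<phi> = "\<lambda>s. levy_semigroup M X (max s 0) g x - g x"
  have "(\<lambda>s. levy_semigroup M X (max s 0) g x) \<in> borel_measurable borel"
    by (rule levy_semigroup_measurable_compose[OF X]) measurable
  then have m: "?\<phi> \<in> borel_measurable borel" by simp
  have "\<bar>levy_semigroup M X (max s 0) g x\<bar> \<le> B" for s
    by (rule levy_semigroup_bound[OF X]) (auto simp: B)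
  then have b: "\<bar>?\<phi> s\<bar> \<le> 2 * B" for s
    using B[of x] by (smt (verit))
  have eq: "indicator {\<epsilon>..} s *\<^sub>R ((levy_semigroup M X s g x - g x) * shifted_density \<alpha> \<epsilon> s)
      = indicator {\<epsilon>..} s * (?\<phi> s * shifted_density \<alpha> \<epsilon> s)" for s
    using \<epsilon> by (auto simp: max_absorb1 split: split_indicator)
  show "set_integrable lborel {\<epsilon>..} (\<lambda>s. (levy_semigroup M X s g x - g x) * shifted_density \<alpha> \<epsilon> s)"
    unfolding set_integrable_def eq by (rule integral_jump_law(1)[OF m b])
  show "approx_neg_frac_power (levy_semigroup M X) \<alpha> \<epsilon> g x = jump_rate \<alpha> \<epsilon> * (\<integral>s. ?\<phi> s \<partial>jump_law \<alpha> \<epsilon>)"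
    unfolding approx_neg_frac_power_def set_lebesgue_integral_def eq by (rule integral_jump_law(2)[OF m b])
qed

text \<open>At fixed x the solution is a Poisson mean in c t, with c the rate and n-th coefficient
  the average of T u h x over a sum of n jumps. Its derivative, computed by forward differences, is
  matched with the operator, and \<open>poisson_mean_taylor\<close> bounds the remainder by a
  constant independent of x.\<close>

lemma subordinate_semigroup_taylor:
  assumes X: "levy_process M X" and S: "subordinator M S" and indep: "independent_processes M X S"
    and laplace: "has_laplace_exponent M S (\<lambda>\<eta>. \<alpha> / \<epsilon> powr \<alpha> * lower_incomplete_gamma \<alpha> (\<eta> * \<epsilon>))"
    and h: "h \<in> borel_measurable borel" "\<And>x. \<bar>h x\<bar> \<le> B" and r: "0 \<le> r" and t: "0 \<le> t"
  shows "\<bar>subordinate_semigroup M X S r h x - subordinate_semigroup M X S t h x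
      - (r - t) * approx_neg_frac_power (levy_semigroup M X) \<alpha> \<epsilon> (subordinate_semigroup M X S t h) x\<bar>
    \<le> 4 * B * (jump_rate \<alpha> \<epsilon>)\<^sup>2 * (r - t)\<^sup>2"
proof -
  interpret prob_space M using X by (simp add: levy_process_def)
  let ?\<mu> = "\<lambda>t. distr M borel (S t)"
  let ?N = "jump_law \<alpha> \<epsilon>" and ?c = "jump_rate \<alpha> \<epsilon>"
  have hB: "h \<in> Bb" using h by (auto simp: Bb_iff)
  define f where "f u = levy_semigroup M X (max u 0) h x" for u
  have f [measurable]: "f \<in> borel_measurable borel"
    unfolding f_def[abs_def] by (rule levy_semigroup_measurable_compose[OF X h(1)]) measurable
  have fB: "\<bar>f u\<bar> \<le> B" for u
    unfolding f_def by (rule levy_semigroup_bound[OF X _ h]) simp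
  interpret N: real_distribution ?N by (rule real_distribution_jump_law)
  have N0: "AE s in ?N. 0 \<le> s"
    using AE_jump_law by eventually_elim (use \<epsilon> in simp)
  \<comment> \<open>Averaging over one further jump; this realises the index shift of the
    coefficients.\<close>
  define g where "g u = (\<integral>s. f (u + s) \<partial>?N)" for u
  have g [measurable]: "g \<in> borel_measurable borel"
    unfolding g_def[abs_def] by (rule N.borel_measurable_lebesgue_integral) measurable
  have gB: "\<bar>g u\<bar> \<le> B" for u
  proof -
    have "\<bar>g u\<bar> \<le> (\<integral>s. \<bar>f (u + s)\<bar> \<partial>?N)" unfolding g_def by (rule integral_abs_bound)
    also have "\<dots> \<le> B" by (intro N.integral_le_const N.integrable_const_bound[where B=B]) (auto simp: fB)
    finally show ?thesis .
  qed
  have Smeas: "S q \<in> borel_measurable M" if "0 \<le> q" for q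
    using S that by (simp add: subordinator_def levy_measurable)
  have \<mu>: "real_distribution (?\<mu> q)" "AE u in ?\<mu> q. 0 \<le> u" if "0 \<le> q" for q
  proof -
    show "real_distribution (?\<mu> q)" by (rule real_distribution_distr[OF Smeas[OF that]])
    show "AE u in ?\<mu> q. 0 \<le> u"
      using subordinator_nonneg[OF S that] by (subst AE_distr_iff[OF Smeas[OF that]]) auto
  qed
  have compound: "(\<integral>u. \<psi> u \<partial>?\<mu> q) = poisson_mean (\<lambda>n. \<integral>u. \<psi> u \<partial>conv_power ?N n) (?c * q)"
    if q: "0 \<le> q" and \<psi>: "\<psi> \<in> borel_measurable borel" "\<And>u. \<bar>\<psi> u\<bar> \<le> B" for q \<psi>
  proof (rule compound_poisson_expectation[OF real_distribution_jump_law N0 \<mu>[OF q] _ _ \<psi>])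
    show "0 \<le> ?c * q" using q jump_rate_pos by simp
    fix \<eta> :: real assume \<eta>: "0 \<le> \<eta>"
    have "(\<integral>u. exp (- \<eta> * u) \<partial>?\<mu> q) = (\<integral>\<omega>. exp (- \<eta> * S q \<omega>) \<partial>M)"
      using Smeas[OF q] by (subst integral_distr) auto
    also have "\<dots> = exp (- q * (\<alpha> / \<epsilon> powr \<alpha> * lower_incomplete_gamma \<alpha> (\<eta> * \<epsilon>)))"
      using laplace q \<eta> unfolding has_laplace_exponent_def by blast
    also have "- q * (\<alpha> / \<epsilon> powr \<alpha> * lower_incomplete_gamma \<alpha> (\<eta> * \<epsilon>)) = ?c * q * ((\<integral>s. exp (- \<eta> * s) \<partial>?N) - 1)"
      using arg_cong[OF laplace_jump_law[OF \<eta>], of "(*) q"] by (simp only: mult_ac mult_minus_left mult_minus_right)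
    finally show "(\<integral>u. exp (- \<eta> * u) \<partial>?\<mu> q) = exp (?c * q * ((\<integral>s. exp (- \<eta> * s) \<partial>?N) - 1))" .
  qed
  define a where "a n = (\<integral>u. f u \<partial>conv_power ?N n)" for n
  have K: "real_distribution (conv_power ?N n)" for n
    by (rule real_distribution_conv_power[OF real_distribution_jump_law])
  have bound: "\<bar>\<integral>u. \<psi> u \<partial>conv_power ?N n\<bar> \<le> B"
    if \<psi>: "\<psi> \<in> borel_measurable borel" "\<And>u. \<bar>\<psi> u\<bar> \<le> B" for \<psi> n
  proof -
    interpret K: real_distribution "conv_power ?N n" by (rule K)
    have "\<bar>\<integral>u. \<psi> u \<partial>conv_power ?N n\<bar> \<le> (\<integral>u. \<bar>\<psi> u\<bar> \<partial>conv_power ?N n)" by (rule integral_abs_bound)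
    also have "\<dots> \<le> B" using \<psi> by (intro K.integral_le_const K.integrable_const_bound[where B=B]) auto
    finally show ?thesis .
  qed
  have aB: "\<bar>a n\<bar> \<le> B" for n unfolding a_def by (rule bound[OF f fB])
  \<comment> \<open>\<open>conv_power\<close> puts the new factor on the right, so the last jump is
    integrated out first, which leaves g.\<close>
  have a_Suc: "a (Suc n) = (\<integral>u. g u \<partial>conv_power ?N n)" for n
    unfolding a_def g_def conv_power.simps
    by (rule integral_convolution[OF K real_distribution_jump_law f fB])
  have sub: "subordinate_semigroup M X S q h x = poisson_mean a (?c * q)" if "0 \<le> q" for q
    by (simp add: subordinate_semigroup_eq[OF X S indep that hB] compound[OF that f fB] a_def[abs_def] flip: f_def)
  interpret \<mu>t: real_distribution "?\<mu> t" by (rule \<mu>[OF t])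
  interpret P: pair_prob_space "?\<mu> t" ?N ..
  \<comment> \<open>With the jump s outside, the inner average over S t is T s applied to the
    solution, by \<open>levy_subordinate_semigroup\<close>.\<close>
  have "(\<integral>u. g u \<partial>?\<mu> t) = (\<integral>s. (\<integral>u. f (u + s) \<partial>?\<mu> t) \<partial>?N)"
  proof -
    have "integrable (?\<mu> t \<Otimes>\<^sub>M ?N) (\<lambda>(u, s). f (u + s))"
      by (rule P.integrable_const_bound[where B=B]) (auto simp: fB)
    from P.Fubini_integral[OF this] show ?thesis by (simp add: g_def)
  qed
  also have "\<dots> = (\<integral>s. levy_semigroup M X (max s 0) (subordinate_semigroup M X S t h) x \<partial>?N)"
  proof (rule integral_cong_AE)
    show "AE s in ?N. (\<integral>u. f (u + s) \<partial>?\<mu> t) = levy_semigroup M X (max s 0) (subordinate_semigroup M X S t h) x"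
      using N0
    proof eventually_elim
      fix s :: real assume s: "0 \<le> s"
      have "AE u in ?\<mu> t. f (u + s) = levy_semigroup M X (s + max u 0) h x"
        using \<mu>(2)[OF t] by eventually_elim (use s in \<open>simp add: f_def max_absorb1 add.commute\<close>)
      moreover have "(\<lambda>u. levy_semigroup M X (s + max u 0) h x) \<in> borel_measurable borel"
      proof -
        have "max (s + max u 0) 0 = s + max u 0" for u :: real using s by simp
        moreover have "(\<lambda>u. levy_semigroup M X (max (s + max u 0) 0) h x) \<in> borel_measurable borel"
          by (rule levy_semigroup_measurable_compose[OF X h(1)]) measurable
        ultimately show ?thesis by (simp only:)
      qed
      ultimately have "(\<integral>u. f (u + s) \<partial>?\<mu> t) = (\<integral>u. levy_semigroup M X (s + max u 0) h x \<partial>?\<mu> t)"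
        by (intro integral_cong_AE) simp_all
      then show "(\<integral>u. f (u + s) \<partial>?\<mu> t) = levy_semigroup M X (max s 0) (subordinate_semigroup M X S t h) x"
        using s by (simp add: levy_subordinate_semigroup[OF X S indep t hB s] max_absorb1)
    qed
    show "(\<lambda>s. levy_semigroup M X (max s 0) (subordinate_semigroup M X S t h) x) \<in> borel_measurable ?N"
      using subordinate_semigroup_Bb[OF X S indep t hB]
      by (intro levy_semigroup_measurable_compose[OF X]) (auto simp: Bb_iff)
    show "(\<lambda>s. \<integral>u. f (u + s) \<partial>?\<mu> t) \<in> borel_measurable ?N"
      by (rule \<mu>t.borel_measurable_lebesgue_integral) measurable
  qed
  finally have g_int: "(\<integral>u. g u \<partial>?\<mu> t) = (\<integral>s. levy_semigroup M X (max s 0) (subordinate_semigroup M X S t h) x \<partial>?N)" .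
  have SB: "subordinate_semigroup M X S t h \<in> Bb" by (rule subordinate_semigroup_Bb[OF X S indep t hB])
  have int: "integrable ?N (\<lambda>s. levy_semigroup M X (max s 0) (subordinate_semigroup M X S t h) x)"
  proof -
    from SB obtain D where D: "subordinate_semigroup M X S t h \<in> borel_measurable borel"
      "\<And>x. \<bar>subordinate_semigroup M X S t h x\<bar> \<le> D" by (auto simp: Bb_iff)
    show ?thesis
      using levy_semigroup_bound[OF X _ D]
      by (intro N.integrable_const_bound[where B=D] levy_semigroup_measurable_compose[OF X D(1)]) auto
  qed
  have "poisson_mean (\<lambda>n. a (Suc n) - a n) (?c * t) = poisson_mean (\<lambda>n. a (Suc n)) (?c * t) - poisson_mean a (?c * t)"
    by (rule poisson_mean_diff[where C=B and D=B]) (auto simp: aB)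
  also have "\<dots> = (\<integral>u. g u \<partial>?\<mu> t) - subordinate_semigroup M X S t h x"
    using compound[OF t g gB] sub[OF t] by (simp add: a_Suc)
  also have "\<dots> = (\<integral>s. (levy_semigroup M X (max s 0) (subordinate_semigroup M X S t h) x - subordinate_semigroup M X S t h x) \<partial>?N)"
    using int N.prob_space by (subst Bochner_Integration.integral_diff) (auto simp: g_int)
  finally have deriv: "approx_neg_frac_power (levy_semigroup M X) \<alpha> \<epsilon> (subordinate_semigroup M X S t h) x
      = ?c * poisson_mean (\<lambda>n. a (Suc n) - a n) (?c * t)"
    using approx_neg_frac_power_jump_law(2)[OF X SB] by simp
  \<comment> \<open>The parameter is rate times time, so one factor of the rate belongs to the
    derivative and two go into the remainder.\<close>
  have "\<bar>poisson_mean a (?c * r) - poisson_mean a (?c * t) - (?c * r - ?c * t) * poisson_mean (\<lambda>n. a (Suc n) - a n) (?c * t)\<bar>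
      \<le> 4 * B * (?c * r - ?c * t)\<^sup>2"
    using r t jump_rate_pos by (intro poisson_mean_taylor aB) auto
  moreover have "?c * r - ?c * t = ?c * (r - t)" by (simp add: right_diff_distrib)
  ultimately show ?thesis
    unfolding deriv sub[OF r] sub[OF t] by (simp add: power_mult_distrib mult_ac)
qed

end

section \<open>Fractional powers on the domain of the generator\<close>

text \<open>For s below some \<delta> the difference quotient is within 1 of the generator, hence
  bounded by D + 1. For larger s the trivial bound 2B is at most (2B / \<delta>) s. The constant is
  the sum of the two.\<close>

lemma generator_domain_bound:
  assumes X: "levy_process M X" and h: "h \<in> Domain (generator (levy_semigroup M X))"
  obtains C where "0 \<le> C" "\<And>s x. 0 < s \<Longrightarrow> \<bar>levy_semigroup M X s h x - h x\<bar> \<le> C * s"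
proof -
  let ?T = "levy_semigroup M X"
  obtain k where hB: "h \<in> Bb" and kB: "k \<in> Bb"
    and lim: "uniform_limit UNIV (\<lambda>t x. (?T t h x - h x) / t) k (at_right 0)"
    using h by (auto simp: generator_def)
  from hB obtain B where B: "h \<in> borel_measurable borel" "\<And>x. \<bar>h x\<bar> \<le> B" by (auto simp: Bb_iff)
  from kB obtain D where D: "\<And>x. \<bar>k x\<bar> \<le> D" by (auto simp: Bb_iff)
  have B0: "0 \<le> B" and D0: "0 \<le> D" using B(2)[of 0] D[of 0] by linarith+
  have "\<forall>\<^sub>F t in at_right 0. \<forall>x. dist ((?T t h x - h x) / t) (k x) < 1"
    using uniform_limitD[OF lim, of 1] by simp
  then obtain \<delta> where \<delta>: "0 < \<delta>" "\<And>t x. 0 < t \<Longrightarrow> t < \<delta> \<Longrightarrow> dist ((?T t h x - h x) / t) (k x) < 1"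
    unfolding eventually_at_right_field by blast
  show thesis
  proof
    show "0 \<le> (D + 1) + 2 * B / \<delta>" using B0 D0 \<delta> by simp
    fix s x :: real assume s: "0 < s"
    show "\<bar>?T s h x - h x\<bar> \<le> ((D + 1) + 2 * B / \<delta>) * s"
    proof (cases "s < \<delta>")
      case True
      have "\<bar>(?T s h x - h x) / s\<bar> \<le> D + 1"
        using \<delta>(2)[OF s True, of x] D[of x] unfolding dist_real_def by linarith
      then have "\<bar>?T s h x - h x\<bar> \<le> (D + 1) * s" using s by (simp add: abs_divide pos_divide_le_eq)
      moreover have "0 \<le> 2 * B / \<delta> * s" using B0 \<delta> s by simp
      ultimately show ?thesis by (simp add: distrib_right)
    next
      case False
      have "\<bar>?T s h x\<bar> \<le> B" using s by (intro levy_semigroup_bound[OF X _ B]) simp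
      then have "\<bar>?T s h x - h x\<bar> \<le> 2 * B" using B(2)[of x] by linarith
      also have "\<dots> = 2 * B / \<delta> * \<delta>" using \<delta> by simp
      also have "\<dots> \<le> 2 * B / \<delta> * s" using False \<delta> B0 by (intro mult_left_mono) auto
      also have "\<dots> \<le> ((D + 1) + 2 * B / \<delta>) * s" using D0 s by (simp add: distrib_right)
      finally show ?thesis .
    qed
  qed
qed

text \<open>The jump-law form gives the bound rate times 2B, and joint measurability of T gives
  measurability in x.\<close>

lemma approx_neg_frac_power_Bb:
  assumes \<alpha>: "0 < \<alpha>" "\<alpha> < 1" and \<epsilon>: "0 < \<epsilon>" and X: "levy_process M X" and g: "g \<in> Bb"
  shows "approx_neg_frac_power (levy_semigroup M X) \<alpha> \<epsilon> g \<in> Bb"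
proof -
  from g obtain B where [measurable]: "g \<in> borel_measurable borel" and B: "\<And>x. \<bar>g x\<bar> \<le> B"
    by (auto simp: Bb_iff)
  interpret N: real_distribution "jump_law \<alpha> \<epsilon>" by (rule real_distribution_jump_law[OF \<alpha> \<epsilon>])
  let ?\<phi> = "\<lambda>x s. levy_semigroup M X (max s 0) g x - g x"
  have b: "\<bar>?\<phi> x s\<bar> \<le> 2 * B" for x s
  proof -
    have "\<bar>levy_semigroup M X (max s 0) g x\<bar> \<le> B"
      by (rule levy_semigroup_bound[OF X]) (auto simp: B)
    then show ?thesis using B[of x] by linarith
  qed
  have "(\<lambda>p. levy_semigroup M X (max (snd p) 0) g (fst p)) \<in> borel_measurable (borel \<Otimes>\<^sub>M jump_law \<alpha> \<epsilon>)"
    by (rule levy_semigroup_measurable_compose[OF X]) measurable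
  then have "(\<lambda>p. ?\<phi> (fst p) (snd p)) \<in> borel_measurable (borel \<Otimes>\<^sub>M jump_law \<alpha> \<epsilon>)" by measurable
  then have m: "(\<lambda>x. \<integral>s. ?\<phi> x s \<partial>jump_law \<alpha> \<epsilon>) \<in> borel_measurable borel"
    by (intro N.borel_measurable_lebesgue_integral) (simp add: case_prod_unfold)
  have "\<bar>\<integral>s. ?\<phi> x s \<partial>jump_law \<alpha> \<epsilon>\<bar> \<le> 2 * B" for x
  proof -
    have "(\<lambda>s. levy_semigroup M X (max s 0) g x) \<in> borel_measurable (jump_law \<alpha> \<epsilon>)"
      by (rule levy_semigroup_measurable_compose[OF X]) measurable
    then have "integrable (jump_law \<alpha> \<epsilon>) (\<lambda>s. \<bar>?\<phi> x s\<bar>)"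
      using b by (intro integrable_abs N.integrable_const_bound[where B="2 * B"]) auto
    with b have "(\<integral>s. \<bar>?\<phi> x s\<bar> \<partial>jump_law \<alpha> \<epsilon>) \<le> 2 * B"
      by (intro N.integral_le_const) auto
    then show ?thesis
      using integral_abs_bound[of "jump_law \<alpha> \<epsilon>" "?\<phi> x"] by linarith
  qed
  then have "\<bar>jump_rate \<alpha> \<epsilon> * (\<integral>s. ?\<phi> x s \<partial>jump_law \<alpha> \<epsilon>)\<bar> \<le> jump_rate \<alpha> \<epsilon> * (2 * B)" for x
    using jump_rate_pos[OF \<alpha> \<epsilon>] by (simp add: abs_mult mult_left_mono)
  with m show ?thesis
    unfolding Bb_iff approx_neg_frac_power_jump_law(2)[OF \<alpha> \<epsilon> X g, abs_def]
    by (auto intro!: exI[of _ "jump_rate \<alpha> \<epsilon> * (2 * B)"])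
qed

text \<open>The linear bound tames the singularity at 0, where s times the stable density is
  integrable, but it fails at infinity; there only boundedness of h helps. Comparison with a shifted
  density handles both ends at once.\<close>

lemma neg_frac_power_domain:
  assumes \<alpha>: "0 < \<alpha>" "\<alpha> < 1" and X: "levy_process M X"
    and h: "h \<in> Bb" and C: "0 \<le> C" "\<And>s x. 0 < s \<Longrightarrow> \<bar>levy_semigroup M X s h x - h x\<bar> \<le> C * s"
  shows "set_integrable lborel {0<..} (\<lambda>s. (levy_semigroup M X s h x - h x) * stable_density \<alpha> s)"
    and "neg_frac_power (levy_semigroup M X) \<alpha> h \<in> Bb"
    and "0 < \<epsilon> \<Longrightarrow> \<bar>approx_neg_frac_power (levy_semigroup M X) \<alpha> \<epsilon> h x - neg_frac_power (levy_semigroup M X) \<alpha> h x\<bar>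
        \<le> C * (\<integral>s. density_gap \<alpha> \<epsilon> s \<partial>lborel)"
proof -
  let ?T = "levy_semigroup M X"
  from h obtain B where hm [measurable]: "h \<in> borel_measurable borel" and B: "\<And>x. \<bar>h x\<bar> \<le> B"
    by (auto simp: Bb_iff)
  let ?\<psi> = "\<lambda>x s. indicator {0<..} s * ((?T (max s 0) h x - h x) * stable_density \<alpha> s)"
  \<comment> \<open>The stable density is split as the shifted density with \<epsilon> = 1 minus
    their difference: the former has finite mass and is met with the bound 2B, the latter with C *
    s. The value 1 is an arbitrary reference.\<close>
  let ?W = "\<lambda>s. 2 * B * (indicator {1..} s * shifted_density \<alpha> 1 s) + C * density_gap \<alpha> 1 s"
  have eq: "indicator {0<..} s *\<^sub>R ((?T s h x - h x) * stable_density \<alpha> s) = ?\<psi> x s" for x s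
    by (auto simp: max_absorb1 split: split_indicator)
  have W: "integrable lborel ?W"
    using shifted_density_mass[OF \<alpha>, of 1] density_gap_integral(1)[OF \<alpha>, of 1]
    by (auto simp: has_bochner_integral_iff)
  have le: "\<bar>?\<psi> x s\<bar> \<le> ?W s" for x s
  proof (cases "0 < s")
    case True
    let ?d = "?T s h x - h x" and ?\<sigma> = "indicator {1..} s * shifted_density \<alpha> 1 s"
    have "\<bar>?T s h x\<bar> \<le> B" using True by (intro levy_semigroup_bound[OF X _ hm B]) simp
    then have d: "\<bar>?d\<bar> \<le> 2 * B" using B[of x] by linarith
    have \<sigma>: "0 \<le> ?\<sigma>" by (simp add: shifted_density_nonneg[OF \<alpha>])
    have "?d * stable_density \<alpha> s = ?d * ?\<sigma> - ?d * (?\<sigma> - stable_density \<alpha> s)" by (simp add: right_diff_distrib)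
    then have "\<bar>?d * stable_density \<alpha> s\<bar> \<le> \<bar>?d\<bar> * \<bar>?\<sigma>\<bar> + \<bar>?d\<bar> * \<bar>?\<sigma> - stable_density \<alpha> s\<bar>"
      by (simp only: abs_mult[symmetric] abs_triangle_ineq4)
    also have "\<dots> \<le> 2 * B * ?\<sigma> + C * s * \<bar>?\<sigma> - stable_density \<alpha> s\<bar>"
      using d \<sigma> C(2)[OF True, of x] by (intro add_mono mult_mono) auto
    also have "\<dots> = ?W s" using True by (simp add: density_gap_def)
    finally show ?thesis using True by (simp add: max_absorb1)
  next
    case False
    have "0 \<le> B" using B[of 0] by linarith
    with False show ?thesis
      using shifted_density_nonneg[OF \<alpha>, of 1 s] density_gap_nonneg[of \<alpha> 1 s] C(1) by simp
  qed
  have m: "(\<lambda>s. ?T (max s 0) h x) \<in> borel_measurable borel" for x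
    by (rule levy_semigroup_measurable_compose[OF X hm]) measurable
  have int: "integrable lborel (?\<psi> x)" for x
  proof (rule Bochner_Integration.integrable_bound[OF W])
    show "?\<psi> x \<in> borel_measurable lborel" using m[of x] by simp
    show "AE s in lborel. norm (?\<psi> x s) \<le> norm (?W s)"
      using le by (auto intro: order_trans[OF _ abs_ge_self])
  qed
  then show "set_integrable lborel {0<..} (\<lambda>s. (?T s h x - h x) * stable_density \<alpha> s)"
    unfolding set_integrable_def eq .
  have neg: "neg_frac_power ?T \<alpha> h x = (\<integral>s. ?\<psi> x s \<partial>lborel)" for x
    unfolding neg_frac_power_def set_lebesgue_integral_def eq ..
  show "neg_frac_power ?T \<alpha> h \<in> Bb"
  proof -
    have [measurable]: "(\<lambda>p. ?T (max (snd p) 0) h (fst p)) \<in> borel_measurable (borel \<Otimes>\<^sub>M lborel)"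
      by (rule levy_semigroup_measurable_compose[OF X hm]) measurable
    have "(\<lambda>x. \<integral>s. ?\<psi> x s \<partial>lborel) \<in> borel_measurable borel"
      by (rule lborel.borel_measurable_lebesgue_integral) (simp add: case_prod_unfold)
    moreover have "\<bar>\<integral>s. ?\<psi> x s \<partial>lborel\<bar> \<le> (\<integral>s. ?W s \<partial>lborel)" for x
    proof -
      have "\<bar>\<integral>s. ?\<psi> x s \<partial>lborel\<bar> \<le> (\<integral>s. \<bar>?\<psi> x s\<bar> \<partial>lborel)" by (rule integral_abs_bound)
      also have "\<dots> \<le> (\<integral>s. ?W s \<partial>lborel)"
        by (rule integral_mono[OF integrable_abs[OF int] W le])
      finally show ?thesis .
    qed
    ultimately show ?thesis unfolding Bb_iff neg[abs_def] by blast
  qed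
  show "\<bar>approx_neg_frac_power ?T \<alpha> \<epsilon> h x - neg_frac_power ?T \<alpha> h x\<bar> \<le> C * (\<integral>s. density_gap \<alpha> \<epsilon> s \<partial>lborel)"
    if \<epsilon>: "0 < \<epsilon>"
  proof -
    let ?\<chi> = "\<lambda>s. indicator {\<epsilon>..} s *\<^sub>R ((?T s h x - h x) * shifted_density \<alpha> \<epsilon> s)"
    have \<chi>: "integrable lborel ?\<chi>"
      using approx_neg_frac_power_jump_law(1)[OF \<alpha> \<epsilon> X h, of x] unfolding set_integrable_def .
    have diff: "approx_neg_frac_power ?T \<alpha> \<epsilon> h x - neg_frac_power ?T \<alpha> h x = (\<integral>s. ?\<chi> s - ?\<psi> x s \<partial>lborel)"
      unfolding neg unfolding approx_neg_frac_power_def set_lebesgue_integral_def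
      by (rule Bochner_Integration.integral_diff[OF \<chi> int, symmetric])
    have "\<bar>\<integral>s. ?\<chi> s - ?\<psi> x s \<partial>lborel\<bar> \<le> (\<integral>s. \<bar>?\<chi> s - ?\<psi> x s\<bar> \<partial>lborel)" by (rule integral_abs_bound)
    also have "\<dots> \<le> (\<integral>s. C * density_gap \<alpha> \<epsilon> s \<partial>lborel)"
    proof (rule integral_mono)
      show "integrable lborel (\<lambda>s. \<bar>?\<chi> s - ?\<psi> x s\<bar>)"
        by (rule integrable_abs, rule Bochner_Integration.integrable_diff[OF \<chi> int])
      show "integrable lborel (\<lambda>s. C * density_gap \<alpha> \<epsilon> s)"
        by (rule integrable_mult_right[OF density_gap_integral(1)[OF \<alpha> \<epsilon>]])
      fix s :: real
      show "\<bar>?\<chi> s - ?\<psi> x s\<bar> \<le> C * density_gap \<alpha> \<epsilon> s"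
      proof (cases "0 < s")
        case True
        have "?\<chi> s - ?\<psi> x s = (?T s h x - h x) * (indicator {\<epsilon>..} s * shifted_density \<alpha> \<epsilon> s - stable_density \<alpha> s)"
          using True by (simp add: max_absorb1 right_diff_distrib mult_ac)
        then have "\<bar>?\<chi> s - ?\<psi> x s\<bar> = \<bar>?T s h x - h x\<bar> * \<bar>indicator {\<epsilon>..} s * shifted_density \<alpha> \<epsilon> s - stable_density \<alpha> s\<bar>"
          by (simp only: abs_mult)
        also have "\<dots> \<le> C * s * \<bar>indicator {\<epsilon>..} s * shifted_density \<alpha> \<epsilon> s - stable_density \<alpha> s\<bar>"
          using C(2)[OF True, of x] by (intro mult_right_mono) auto
        also have "\<dots> = C * density_gap \<alpha> \<epsilon> s" using True by (simp add: density_gap_def)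
        finally show ?thesis .
      next
        case False
        with \<epsilon> show ?thesis by (simp add: density_gap_def)
      qed
    qed
    finally show ?thesis unfolding diff by simp
  qed
qed

text \<open>The pointwise error is C times the mass of the gap, a bound free of x that vanishes as
  \<epsilon> tends to 0 because 1 - \<alpha> > 0.\<close>

lemma approx_neg_frac_power_limit:
  assumes \<alpha>: "0 < \<alpha>" "\<alpha> < 1" and X: "levy_process M X"
    and h: "h \<in> Bb" and C: "0 \<le> C" "\<And>s x. 0 < s \<Longrightarrow> \<bar>levy_semigroup M X s h x - h x\<bar> \<le> C * s"
  shows "uniform_limit UNIV (\<lambda>\<epsilon>. approx_neg_frac_power (levy_semigroup M X) \<alpha> \<epsilon> h)
    (neg_frac_power (levy_semigroup M X) \<alpha> h) (at_right 0)"
proof (rule uniform_limitI)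
  fix e :: real assume e: "0 < e"
  define K where "K = C * (\<alpha> / Gamma (1 - \<alpha>)) / (1 - \<alpha>)"
  have "((\<lambda>\<epsilon>. \<epsilon> powr (1 - \<alpha>) + (2 * \<epsilon>) powr (1 - \<alpha>)) \<longlongrightarrow> 0) (at_right 0)"
    using \<alpha> by real_asymp
  then have "((\<lambda>\<epsilon>. K * (\<epsilon> powr (1 - \<alpha>) + (2 * \<epsilon>) powr (1 - \<alpha>))) \<longlongrightarrow> 0) (at_right 0)"
    by (rule tendsto_mult_right_zero)
  then have "\<forall>\<^sub>F \<epsilon> in at_right 0. K * (\<epsilon> powr (1 - \<alpha>) + (2 * \<epsilon>) powr (1 - \<alpha>)) < e"
    using e by (rule order_tendstoD)
  then show "\<forall>\<^sub>F \<epsilon> in at_right 0. \<forall>x\<in>UNIV. dist (approx_neg_frac_power (levy_semigroup M X) \<alpha> \<epsilon> h x)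
      (neg_frac_power (levy_semigroup M X) \<alpha> h x) < e"
    using eventually_at_right_less[of 0]
  proof eventually_elim
    case (elim \<epsilon>)
    have "C * (\<integral>s. density_gap \<alpha> \<epsilon> s \<partial>lborel)
        \<le> C * (\<alpha> / Gamma (1 - \<alpha>) * (\<epsilon> powr (1 - \<alpha>) + (2 * \<epsilon>) powr (1 - \<alpha>)) / (1 - \<alpha>))"
      using C(1) elim(2) by (intro mult_left_mono density_gap_integral(2)[OF \<alpha>])
    also have "\<dots> = K * (\<epsilon> powr (1 - \<alpha>) + (2 * \<epsilon>) powr (1 - \<alpha>))" by (simp add: K_def)
    finally show ?case
      using neg_frac_power_domain(3)[OF \<alpha> X h C elim(2)] elim(1)
      unfolding dist_real_def by (meson order_le_less_trans order_trans)
  qed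
qed

lemma uniform_limit_difference_quotient:
  fixes F :: "real \<Rightarrow> 'b \<Rightarrow> real"
  assumes "\<And>r x. 0 \<le> r \<Longrightarrow> \<bar>F r x - F t x - (r - t) * L x\<bar> \<le> K * (r - t)\<^sup>2"
  shows "uniform_limit UNIV (\<lambda>r x. (F r x - F t x) / (r - t)) L (at t within {0..})"
proof (rule uniform_limitI)
  fix e :: real assume e: "0 < e"
  \<comment> \<open>The sign of K is arbitrary; |K| + 1 is a positive majorant, so the radius is
    well defined and the last inequality strict.\<close>
  have "\<bar>(F r x - F t x) / (r - t) - L x\<bar> < e"
    if r: "0 \<le> r" "r \<noteq> t" "dist r t < e / (\<bar>K\<bar> + 1)" for r x
  proof -
    have "(F r x - F t x) / (r - t) - L x = (F r x - F t x - (r - t) * L x) / (r - t)"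
      using r by (simp add: field_simps)
    then have "\<bar>(F r x - F t x) / (r - t) - L x\<bar> \<le> K * (r - t)\<^sup>2 / \<bar>r - t\<bar>"
      using assms[OF r(1), of x] by (simp add: abs_divide divide_right_mono)
    also have "(r - t)\<^sup>2 = \<bar>r - t\<bar> * \<bar>r - t\<bar>" by (simp add: power2_eq_square)
    also have "K * (\<bar>r - t\<bar> * \<bar>r - t\<bar>) / \<bar>r - t\<bar> = K * \<bar>r - t\<bar>"
      using r(2) by (simp del: abs_mult_self_eq)
    also have "\<dots> \<le> (\<bar>K\<bar> + 1) * \<bar>r - t\<bar>" by (intro mult_right_mono) auto
    also have "\<dots> < e"
      using r(3) by (simp add: dist_real_def pos_less_divide_eq mult.commute add_nonneg_pos)
    finally show ?thesis .
  qed
  moreover have "0 < e / (\<bar>K\<bar> + 1)" using e by (simp add: add_nonneg_pos)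
  ultimately show "\<forall>\<^sub>F r in at t within {0..}. \<forall>x\<in>UNIV. dist ((F r x - F t x) / (r - t)) (L x) < e"
    unfolding eventually_at dist_real_def by (intro exI[of _ "e / (\<bar>K\<bar> + 1)"]) auto
qed

lemma subordinate_semigroup_0:
  assumes X: "levy_process M X" and S: "subordinator M S" and h: "h \<in> Bb"
  shows "subordinate_semigroup M X S 0 h x = h x"
proof -
  interpret prob_space M using X by (simp add: levy_process_def)
  have [measurable]: "h \<in> borel_measurable borel" using h by (simp add: Bb_iff)
  have S0: "S 0 \<in> borel_measurable M" using S by (simp add: subordinator_def levy_measurable)
  have [measurable]: "(\<lambda>\<omega>. X (S 0 \<omega>) \<omega>) \<in> borel_measurable M"
    using subordinator_nonneg[OF S, of 0] by (intro levy_measurable_time_change[OF X S0]) simp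
  have "AE \<omega> in M. X 0 \<omega> = 0" "AE \<omega> in M. S 0 \<omega> = 0"
    using X S by (simp_all add: levy_process_def subordinator_def)
  then have "AE \<omega> in M. h (x + X (S 0 \<omega>) \<omega>) = h x" by eventually_elim simp
  then have "subordinate_semigroup M X S 0 h x = (\<integral>\<omega>. h x \<partial>M)"
    unfolding subordinate_semigroup_def by (intro integral_cong_AE) auto
  then show ?thesis by (simp add: prob_space)
qed

text \<open>The equation is stated pointwise and in the sup-norm, with one-sided derivative at t =
  0. Integrability is asserted next to each operator because the Lebesgue integral of a
  non-integrable function is 0 by convention. Convergence of the operators is uniform in x.\<close>

theorem mainTheorem8:
  fixes M :: "'a measure" and X :: "real \<Rightarrow> 'a \<Rightarrow> real" and \<alpha> :: real
  assumes "0 < \<alpha>" and "\<alpha> < 1"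
    and "levy_process M X"
  shows
    "(\<forall>\<epsilon>>0. \<forall>S. \<forall>h \<in> Domain (generator (levy_semigroup M X)).
        subordinator M S \<longrightarrow>
        independent_processes M X S \<longrightarrow>
        has_laplace_exponent M S
          (\<lambda>\<eta>. \<alpha> / \<epsilon> powr \<alpha> * lower_incomplete_gamma \<alpha> (\<eta> * \<epsilon>)) \<longrightarrow>
        (\<forall>t\<ge>0.
           subordinate_semigroup M X S t h \<in> Bb \<and>
           (\<forall>x.
              set_integrable lborel {\<epsilon>..}
                (\<lambda>s. (levy_semigroup M X s (subordinate_semigroup M X S t h) x
                        - subordinate_semigroup M X S t h x) * shifted_density \<alpha> \<epsilon> s) \<and>
              ((\<lambda>r. subordinate_semigroup M X S r h x) has_real_derivative
                 approx_neg_frac_power (levy_semigroup M X) \<alpha> \<epsilon>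
                   (subordinate_semigroup M X S t h) x) (at t within {0..})) \<and>
           uniform_limit UNIV
             (\<lambda>r x. (subordinate_semigroup M X S r h x - subordinate_semigroup M X S t h x)
                      / (r - t))
             (approx_neg_frac_power (levy_semigroup M X) \<alpha> \<epsilon> (subordinate_semigroup M X S t h))
             (at t within {0..})) \<and>
        (\<forall>x. subordinate_semigroup M X S 0 h x = h x)) \<and>
     (\<forall>h \<in> Domain (generator (levy_semigroup M X)).
        (\<forall>x. set_integrable lborel {0<..}
               (\<lambda>s. (levy_semigroup M X s h x - h x) * stable_density \<alpha> s)) \<and>
        neg_frac_power (levy_semigroup M X) \<alpha> h \<in> Bb \<and>
        (\<forall>\<epsilon>>0.
           (\<forall>x. set_integrable lborel {\<epsilon>..}
                  (\<lambda>s. (levy_semigroup M X s h x - h x) * shifted_density \<alpha> \<epsilon> s)) \<and>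
           approx_neg_frac_power (levy_semigroup M X) \<alpha> \<epsilon> h \<in> Bb) \<and>
        uniform_limit UNIV
          (\<lambda>\<epsilon>. approx_neg_frac_power (levy_semigroup M X) \<alpha> \<epsilon> h)
          (neg_frac_power (levy_semigroup M X) \<alpha> h)
          (at_right 0))"
proof (intro conjI allI impI ballI)
  note \<alpha> = assms(1,2) and X = assms(3)
  let ?T = "levy_semigroup M X"
  {
    fix \<epsilon> :: real and S h
    assume \<epsilon>: "0 < \<epsilon>" and h: "h \<in> Domain (generator ?T)" and S: "subordinator M S"
      and indep: "independent_processes M X S"
      and laplace: "has_laplace_exponent M S (\<lambda>\<eta>. \<alpha> / \<epsilon> powr \<alpha> * lower_incomplete_gamma \<alpha> (\<eta> * \<epsilon>))"
    have hB: "h \<in> Bb" using h by (auto simp: generator_def)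
    then obtain B where B: "h \<in> borel_measurable borel" "\<And>x. \<bar>h x\<bar> \<le> B" by (auto simp: Bb_iff)
    show "subordinate_semigroup M X S 0 h x = h x" for x
      by (rule subordinate_semigroup_0[OF X S hB])
    fix t :: real assume t: "0 \<le> t"
    show SB: "subordinate_semigroup M X S t h \<in> Bb"
      by (rule subordinate_semigroup_Bb[OF X S indep t hB])
    show "set_integrable lborel {\<epsilon>..}
        (\<lambda>s. (?T s (subordinate_semigroup M X S t h) x - subordinate_semigroup M X S t h x) * shifted_density \<alpha> \<epsilon> s)" for x
      by (rule approx_neg_frac_power_jump_law(1)[OF \<alpha> \<epsilon> X SB])
    show lim: "uniform_limit UNIV
        (\<lambda>r x. (subordinate_semigroup M X S r h x - subordinate_semigroup M X S t h x) / (r - t))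
        (approx_neg_frac_power ?T \<alpha> \<epsilon> (subordinate_semigroup M X S t h)) (at t within {0..})"
      by (rule uniform_limit_difference_quotient)
        (rule subordinate_semigroup_taylor[OF \<alpha> \<epsilon> X S indep laplace B _ t])
    \<comment> \<open>The pointwise derivative is the sup-norm limit of the difference quotients,
      read at a single x.\<close>
    show "((\<lambda>r. subordinate_semigroup M X S r h x) has_real_derivative
        approx_neg_frac_power ?T \<alpha> \<epsilon> (subordinate_semigroup M X S t h) x) (at t within {0..})" for x
      unfolding has_field_derivative_iff by (rule tendsto_uniform_limitI[OF lim UNIV_I])
  }
  fix h assume h: "h \<in> Domain (generator ?T)"
  then have hB: "h \<in> Bb" by (auto simp: generator_def)
  obtain C where C: "0 \<le> C" "\<And>s x. 0 < s \<Longrightarrow> \<bar>?T s h x - h x\<bar> \<le> C * s"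
    using generator_domain_bound[OF X h] by blast
  show "set_integrable lborel {0<..} (\<lambda>s. (?T s h x - h x) * stable_density \<alpha> s)" for x
    by (rule neg_frac_power_domain(1)[OF \<alpha> X hB C])
  show "neg_frac_power ?T \<alpha> h \<in> Bb"
    by (rule neg_frac_power_domain(2)[OF \<alpha> X hB C])
  show "set_integrable lborel {\<epsilon>..} (\<lambda>s. (?T s h x - h x) * shifted_density \<alpha> \<epsilon> s)" if "0 < \<epsilon>" for \<epsilon> x
    by (rule approx_neg_frac_power_jump_law(1)[OF \<alpha> that X hB])
  show "approx_neg_frac_power ?T \<alpha> \<epsilon> h \<in> Bb" if "0 < \<epsilon>" for \<epsilon>
    by (rule approx_neg_frac_power_Bb[OF \<alpha> that X hB])
  show "uniform_limit UNIV (\<lambda>\<epsilon>. approx_neg_frac_power ?T \<alpha> \<epsilon> h) (neg_frac_power ?T \<alpha> h) (at_right 0)"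
    by (rule approx_neg_frac_power_limit[OF \<alpha> X hB C])
qed

end
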